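(* Every Coxeter group is almost profinitely rigid amongst Coxeter groups if and only if every one-ended Coxeter group is almost profinitely rigid amongst Coxeter groups.
   Context: A Coxeter graph is a finite simplicial graph $\Gamma$ with edge labelling $m\colon E(\Gamma)\to\mathbb{N}_{\geq 2}$; the Coxeter group is $W_\Gamma=\langle V(\Gamma)\mid v^2,\ (vw)^{m(\{v,w\})}\text{ for }\{v,w\}\in E(\Gamma)\rangle$. A Coxeter group $W$ is almost profinitely rigid amongst Coxeter groups if there are only finitely many isomorphism classes of Coxeter groups $W'$ with $\widehat{W'}\cong\widehat W$ ($\widehat{\ }$ the profinite completion). *)

theory Defs
  imports "HOL-Algebra.Coset" "HOL-Analysis.Function_Topology"
begin

type_synonym cox_graph = "nat set \<times> nat set set \<times> (nat set \<Rightarrow> nat)"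

definition coxeter_graph :: "cox_graph \<Rightarrow> bool" where
  "coxeter_graph \<Gamma> \<longleftrightarrow> (case \<Gamma> of (V, E, m) \<Rightarrow>
      finite V \<and> (\<forall>e\<in>E. e \<subseteq> V \<and> card e = 2) \<and> (\<forall>e\<in>E. m e \<ge> 2))"

text \<open>The congruence on words over V generated by the defining relators v^2 and
(vw)^m(v,w). Since all generators are involutions, words over V represent all
elements of the presented group.\<close>

inductive_set cox_rel :: "nat set \<Rightarrow> nat set set \<Rightarrow> (nat set \<Rightarrow> nat) \<Rightarrow> (nat list \<times> nat list) set"
  for V E m where
  refl: "w \<in> lists V \<Longrightarrow> (w, w) \<in> cox_rel V E m"
| sym: "(u, w) \<in> cox_rel V E m \<Longrightarrow> (w, u) \<in> cox_rel V E m"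
| trans: "(u, w) \<in> cox_rel V E m \<Longrightarrow> (w, z) \<in> cox_rel V E m \<Longrightarrow> (u, z) \<in> cox_rel V E m"
| square: "xs \<in> lists V \<Longrightarrow> ys \<in> lists V \<Longrightarrow> v \<in> V \<Longrightarrow>
     (xs @ [v, v] @ ys, xs @ ys) \<in> cox_rel V E m"
| braid: "xs \<in> lists V \<Longrightarrow> ys \<in> lists V \<Longrightarrow> v \<in> V \<Longrightarrow> w \<in> V \<Longrightarrow> {v, w} \<in> E \<Longrightarrow>
     (xs @ concat (replicate (m {v, w}) [v, w]) @ ys, xs @ ys) \<in> cox_rel V E m"

definition cox_group :: "cox_graph \<Rightarrow> nat list set monoid" where
  "cox_group \<Gamma> = (case \<Gamma> of (V, E, m) \<Rightarrow>
     \<lparr> carrier = lists V // cox_rel V E m,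
       mult = (\<lambda>A B. \<Union>a\<in>A. \<Union>b\<in>B. cox_rel V E m `` {a @ b}),
       one = cox_rel V E m `` {[]} \<rparr>)"

definition cox_gens :: "cox_graph \<Rightarrow> nat list set set" where
  "cox_gens \<Gamma> = (case \<Gamma> of (V, E, m) \<Rightarrow> (\<lambda>v. cox_rel V E m `` {[v]}) ` V)"

definition fin_normals :: "('a, 'b) monoid_scheme \<Rightarrow> 'a set set" where
  "fin_normals G = {N. N \<lhd> G \<and> finite (rcosets\<^bsub>G\<^esub> N)}"

definition prof_completion :: "('a, 'b) monoid_scheme \<Rightarrow> ('a set \<Rightarrow> 'a set) monoid" where
  "prof_completion G =
     \<lparr> carrier = {f \<in> (\<Pi>\<^sub>E N\<in>fin_normals G. rcosets\<^bsub>G\<^esub> N).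
                    \<forall>N\<in>fin_normals G. \<forall>M\<in>fin_normals G. N \<subseteq> M \<longrightarrow> f N \<subseteq> f M},
       mult = (\<lambda>f g. \<lambda>N\<in>fin_normals G. f N <#>\<^bsub>G\<^esub> g N),
       one = (\<lambda>N\<in>fin_normals G. N) \<rparr>"

definition prof_topology :: "('a, 'b) monoid_scheme \<Rightarrow> ('a set \<Rightarrow> 'a set) topology" where
  "prof_topology G =
     subtopology (product_topology (\<lambda>N. discrete_topology (rcosets\<^bsub>G\<^esub> N)) (fin_normals G))
                 (carrier (prof_completion G))"

definition prof_iso :: "('a, 'b) monoid_scheme \<Rightarrow> ('c, 'd) monoid_scheme \<Rightarrow> bool" where
  "prof_iso G H \<longleftrightarrow> (\<exists>\<phi>. \<phi> \<in> iso (prof_completion G) (prof_completion H) \<and>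
                         homeomorphic_map (prof_topology G) (prof_topology H) \<phi>)"

text \<open>Finitely many isomorphism classes of Coxeter groups W' with profinite completion
isomorphic to that of W_Gamma (every Coxeter group is isomorphic to one on a vertex set
of natural numbers).\<close>

definition almost_prof_rigid :: "cox_graph \<Rightarrow> bool" where
  "almost_prof_rigid \<Gamma> \<longleftrightarrow>
     finite ({\<Gamma>'. coxeter_graph \<Gamma>' \<and> prof_iso (cox_group \<Gamma>') (cox_group \<Gamma>)}
             // {(\<Gamma>1, \<Gamma>2). cox_group \<Gamma>1 \<cong> cox_group \<Gamma>2})"

definition cayley_step :: "('a, 'b) monoid_scheme \<Rightarrow> 'a set \<Rightarrow> 'a set \<Rightarrow> ('a \<times> 'a) set" where
  "cayley_step G S K = {(g, h). g \<in> carrier G \<and> g \<notin> K \<and> h \<notin> K \<and>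
       (\<exists>s\<in>S. h = g \<otimes>\<^bsub>G\<^esub> s \<or> h = g \<otimes>\<^bsub>G\<^esub> inv\<^bsub>G\<^esub> s)}"

definition cayley_component :: "('a, 'b) monoid_scheme \<Rightarrow> 'a set \<Rightarrow> 'a set \<Rightarrow> 'a \<Rightarrow> 'a set" where
  "cayley_component G S K g = {h. (g, h) \<in> (cayley_step G S K)\<^sup>*}"

definition one_ended :: "('a, 'b) monoid_scheme \<Rightarrow> 'a set \<Rightarrow> bool" where
  "one_ended G S \<longleftrightarrow> infinite (carrier G) \<and>
     (\<forall>K. K \<subseteq> carrier G \<and> finite K \<longrightarrow>
        card {C. \<exists>g\<in>carrier G - K. C = cayley_component G S K g \<and> infinite C} = 1)"

end

theory Submission
  imports Defs "HOL-Algebra.Generated_Groups" "HOL-Analysis.Product_Topology"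
begin

text \<open>Let \<open>D\<close> be the infinite dihedral group. Adding two vertices to \<open>\<Gamma>\<close>, not joined to each
other and joined to every old vertex by an edge labelled 2, replaces \<open>W\<close> by \<open>W \<times> D\<close>. A product
of two infinite groups is one-ended, so \<open>W \<times> D \<times> D\<close> is one-ended for every Coxeter group \<open>W\<close>,
finite or not. Profinite completion commutes with products, hence \<open>W' \<mapsto> W' \<times> D\<close> preserves
isomorphism of profinite completions. Finally \<open>D\<close> can be cancelled from direct products, because
two commuting subsets with product \<open>D\<close> cannot both be nontrivial; so \<open>W' \<mapsto> W' \<times> D\<close> is injective
on isomorphism classes, and almost rigidity of \<open>W \<times> D \<times> D\<close> descends to \<open>W \<times> D\<close> and then to \<open>W\<close>.\<close>

section \<open>Cancellation of direct factors\<close>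

text \<open>Almost rigidity counts isomorphism classes of abstract groups, so \<open>D\<close> is
  cancelled only from abstract groups; on the profinite side a product with \<open>D\<close> is only
  formed, by functoriality. The obstacle is that direct factors do not cancel in general, since an
  isomorphism \<open>G \<times> D \<cong> H \<times> D\<close> need not respect the two
  decompositions. The added factor thus has to meet three demands at once: it must be a Coxeter
  group, so that the product stays in the class; it must be infinite, so that it acts on ends; and
  it must be cancellable. The infinite dihedral group qualifies because it has trivial centre and no
  proper direct decomposition.\<close>

text \<open>A slight strengthening of ``centreless and directly indecomposable'': \<open>A\<close> and \<open>B\<close> are
arbitrary subsets, so that images of direct factors need not be shown to be subgroups.\<close>

definition commuting_indecomposable :: "('a, 'b) monoid_scheme \<Rightarrow> bool" where
  "commuting_indecomposable D \<longleftrightarrow> (\<forall>A B. A \<subseteq> carrier D \<longrightarrow> B \<subseteq> carrier D \<longrightarrow>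
     (\<forall>a\<in>A. \<forall>b\<in>B. a \<otimes>\<^bsub>D\<^esub> b = b \<otimes>\<^bsub>D\<^esub> a) \<longrightarrow>
     (\<forall>x\<in>carrier D. \<exists>a\<in>A. \<exists>b\<in>B. x = a \<otimes>\<^bsub>D\<^esub> b) \<longrightarrow>
     A \<subseteq> {\<one>\<^bsub>D\<^esub>} \<or> B \<subseteq> {\<one>\<^bsub>D\<^esub>})"

text \<open>The two factors of the source commute elementwise and multiply to everything. Both
  properties survive a surjection followed by the projection to \<open>D\<close>, where
  indecomposability forces one of the two images to be trivial.\<close>

lemma snd_factor_trivial:
  assumes G: "group G" and H: "group H" and D: "group D"
    and ind: "commuting_indecomposable D"
    and hom: "\<phi> \<in> hom (H \<times>\<times> D) (G \<times>\<times> D)"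
    and surj: "\<phi> ` carrier (H \<times>\<times> D) = carrier (G \<times>\<times> D)"
  shows "(\<forall>d\<in>carrier D. snd (\<phi> (\<one>\<^bsub>H\<^esub>, d)) = \<one>\<^bsub>D\<^esub>) \<or> (\<forall>h\<in>carrier H. snd (\<phi> (h, \<one>\<^bsub>D\<^esub>)) = \<one>\<^bsub>D\<^esub>)"
proof -
  interpret G: group G by fact
  interpret H: group H by fact
  interpret D: group D by fact
  let ?A = "(\<lambda>d. snd (\<phi> (\<one>\<^bsub>H\<^esub>, d))) ` carrier D"
  let ?B = "(\<lambda>h. snd (\<phi> (h, \<one>\<^bsub>D\<^esub>))) ` carrier H"
  have cl: "snd (\<phi> (h, d)) \<in> carrier D" if "h \<in> carrier H" "d \<in> carrier D" for h d
    using hom_in_carrier[OF hom, of "(h, d)"] that by auto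
  have ml: "snd (\<phi> (h \<otimes>\<^bsub>H\<^esub> h', d \<otimes>\<^bsub>D\<^esub> d')) = snd (\<phi> (h, d)) \<otimes>\<^bsub>D\<^esub> snd (\<phi> (h', d'))"
    if "h \<in> carrier H" "d \<in> carrier D" "h' \<in> carrier H" "d' \<in> carrier D" for h d h' d'
    using hom_mult[OF hom, of "(h, d)" "(h', d')"] that by (simp add: mult_DirProd')
  have "\<forall>a\<in>?A. \<forall>b\<in>?B. a \<otimes>\<^bsub>D\<^esub> b = b \<otimes>\<^bsub>D\<^esub> a"
    using ml[of "\<one>\<^bsub>H\<^esub>" _ _ "\<one>\<^bsub>D\<^esub>"] ml[of _ "\<one>\<^bsub>D\<^esub>" "\<one>\<^bsub>H\<^esub>"] by (auto simp flip: ml)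
  moreover have "\<forall>x\<in>carrier D. \<exists>a\<in>?A. \<exists>b\<in>?B. x = a \<otimes>\<^bsub>D\<^esub> b"
  proof
    fix x assume "x \<in> carrier D"
    then have "(\<one>\<^bsub>G\<^esub>, x) \<in> \<phi> ` carrier (H \<times>\<times> D)" using surj by auto
    then obtain h d where hd: "h \<in> carrier H" "d \<in> carrier D" "\<phi> (h, d) = (\<one>\<^bsub>G\<^esub>, x)" by auto
    then have "x = snd (\<phi> (\<one>\<^bsub>H\<^esub>, d)) \<otimes>\<^bsub>D\<^esub> snd (\<phi> (h, \<one>\<^bsub>D\<^esub>))"
      using ml[of "\<one>\<^bsub>H\<^esub>" d h "\<one>\<^bsub>D\<^esub>"] by simp
    with hd show "\<exists>a\<in>?A. \<exists>b\<in>?B. x = a \<otimes>\<^bsub>D\<^esub> b" by blast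
  qed
  moreover have "?A \<subseteq> carrier D" "?B \<subseteq> carrier D" using cl by auto
  ultimately have "?A \<subseteq> {\<one>\<^bsub>D\<^esub>} \<or> ?B \<subseteq> {\<one>\<^bsub>D\<^esub>}"
    using ind unfolding commuting_indecomposable_def by blast
  then show ?thesis by blast
qed

text \<open>If \<open>\<phi> (g, \<one>) = (h, d)\<close> and \<open>\<phi> (\<one>, d) = (h', \<one>)\<close>, then \<open>twist\<close> sends \<open>g\<close> to \<open>h h'\<close>: it
exchanges the copy of \<open>D\<close> inside the first complement for the copy inside the second.
When the two complements coincide, \<open>d = \<one>\<close> and it is just the first component of \<open>\<phi>\<close>.\<close>

definition twist :: "('a \<times> 'd \<Rightarrow> 'b \<times> 'd) \<Rightarrow> 'd \<Rightarrow> 'a \<Rightarrow> 'b" where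
  "twist \<phi> e g = fst (\<phi> (g, snd (\<phi> (g, e))))"

text \<open>In both cases \<open>\<phi> (g, d) = (h, d)\<close> for the \<open>d\<close> that
  \<open>g\<close> produces, and \<open>\<psi>\<close> produces the same \<open>d\<close> from
  \<open>h\<close>. The second twist therefore evaluates \<open>\<psi>\<close> exactly at
  \<open>\<phi> (g, d)\<close>.\<close>

lemma twist_left_inverse:
  assumes G: "group G" and H: "group H" and D: "group D"
    and hom: "\<phi> \<in> hom (G \<times>\<times> D) (H \<times>\<times> D)" and hom': "\<psi> \<in> hom (H \<times>\<times> D) (G \<times>\<times> D)"
    and inv: "\<And>x. x \<in> carrier (G \<times>\<times> D) \<Longrightarrow> \<psi> (\<phi> x) = x"
    and triv: "(\<forall>d\<in>carrier D. snd (\<phi> (\<one>\<^bsub>G\<^esub>, d)) = \<one>\<^bsub>D\<^esub> \<and> snd (\<psi> (\<one>\<^bsub>H\<^esub>, d)) = \<one>\<^bsub>D\<^esub>) \<or>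
       (\<forall>g\<in>carrier G. snd (\<phi> (g, \<one>\<^bsub>D\<^esub>)) = \<one>\<^bsub>D\<^esub>)"
    and g: "g \<in> carrier G"
  shows "twist \<psi> \<one>\<^bsub>D\<^esub> (twist \<phi> \<one>\<^bsub>D\<^esub> g) = g"
proof -
  interpret G: group G by fact
  interpret H: group H by fact
  interpret D: group D by fact
  define d where "d = snd (\<phi> (g, \<one>\<^bsub>D\<^esub>))"
  define h where "h = fst (\<phi> (g, d))"
  have d: "d \<in> carrier D" using hom_in_carrier[OF hom, of "(g, \<one>\<^bsub>D\<^esub>)"] g by (auto simp: d_def)
  have h: "h \<in> carrier H" using hom_in_carrier[OF hom, of "(g, d)"] g d by (auto simp: h_def)
  have e1: "\<phi> (g, d) = \<phi> (g, \<one>\<^bsub>D\<^esub>) \<otimes>\<^bsub>H \<times>\<times> D\<^esub> \<phi> (\<one>\<^bsub>G\<^esub>, d)"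
    using hom_mult[OF hom, of "(g, \<one>\<^bsub>D\<^esub>)" "(\<one>\<^bsub>G\<^esub>, d)"] g d by simp
  have e2: "\<psi> (h, d) = \<psi> (h, \<one>\<^bsub>D\<^esub>) \<otimes>\<^bsub>G \<times>\<times> D\<^esub> \<psi> (\<one>\<^bsub>H\<^esub>, d)"
    using hom_mult[OF hom', of "(h, \<one>\<^bsub>D\<^esub>)" "(\<one>\<^bsub>H\<^esub>, d)"] h d by simp
  have c: "snd (\<psi> (h, \<one>\<^bsub>D\<^esub>)) \<in> carrier D"
    using hom_in_carrier[OF hom', of "(h, \<one>\<^bsub>D\<^esub>)"] h by auto
  have "\<phi> (g, d) = (h, d) \<and> snd (\<psi> (h, \<one>\<^bsub>D\<^esub>)) = d"
    using triv
  proof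
    assume t: "\<forall>d\<in>carrier D. snd (\<phi> (\<one>\<^bsub>G\<^esub>, d)) = \<one>\<^bsub>D\<^esub> \<and> snd (\<psi> (\<one>\<^bsub>H\<^esub>, d)) = \<one>\<^bsub>D\<^esub>"
    \<comment> \<open>The copy of \<open>D\<close> contributes nothing to second components here, so
      those of \<open>\<phi> (g, d)\<close> and \<open>\<psi> (h, d)\<close> are determined by
      \<open>g\<close> and \<open>h\<close> alone.\<close>
    have "snd (\<phi> (g, d)) = d" using e1 t d by (simp add: mult_DirProd' d_def[symmetric])
    then have p: "\<phi> (g, d) = (h, d)" by (simp add: h_def prod_eq_iff)
    then have "\<psi> (h, d) = (g, d)" using inv[of "(g, d)"] g d by simp
    then have "snd (\<psi> (h, \<one>\<^bsub>D\<^esub>)) = d" using e2 t d c by (simp add: mult_DirProd')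
    with p show ?thesis by simp
  next
    assume "\<forall>g\<in>carrier G. snd (\<phi> (g, \<one>\<^bsub>D\<^esub>)) = \<one>\<^bsub>D\<^esub>"
    then have "d = \<one>\<^bsub>D\<^esub>" using g by (simp add: d_def)
    then have "\<phi> (g, d) = (h, d)" by (metis d_def h_def prod.collapse)
    then show ?thesis using inv[of "(g, d)"] g d \<open>d = \<one>\<^bsub>D\<^esub>\<close> by simp
  qed
  then have "fst (\<psi> (h, snd (\<psi> (h, \<one>\<^bsub>D\<^esub>)))) = g" using inv[of "(g, d)"] g d by auto
  then show ?thesis by (simp add: twist_def h_def d_def)
qed

text \<open>This is a composite of homomorphisms: the graph map
  \<open>g \<mapsto> (g, snd (\<phi> (g, \<one>)))\<close> into \<open>G \<times> D\<close>, then
  \<open>\<phi>\<close>, then the first projection.\<close>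

lemma twist_hom:
  assumes G: "group G" and H: "group H" and D: "group D"
    and hom: "\<phi> \<in> hom (G \<times>\<times> D) (H \<times>\<times> D)"
  shows "twist \<phi> \<one>\<^bsub>D\<^esub> \<in> hom G H"
proof -
  interpret G: group G by fact
  interpret H: group H by fact
  interpret D: group D by fact
  have cl: "snd (\<phi> (g, \<one>\<^bsub>D\<^esub>)) \<in> carrier D" if "g \<in> carrier G" for g
    using hom_in_carrier[OF hom, of "(g, \<one>\<^bsub>D\<^esub>)"] that by auto
  show ?thesis
  proof (rule homI)
    fix g assume g: "g \<in> carrier G"
    then show "twist \<phi> \<one>\<^bsub>D\<^esub> g \<in> carrier H"
      using hom_in_carrier[OF hom, of "(g, snd (\<phi> (g, \<one>\<^bsub>D\<^esub>)))"] cl by (auto simp: twist_def)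
  next
    fix g g' assume g: "g \<in> carrier G" "g' \<in> carrier G"
    have "snd (\<phi> (g \<otimes>\<^bsub>G\<^esub> g', \<one>\<^bsub>D\<^esub>)) = snd (\<phi> (g, \<one>\<^bsub>D\<^esub>)) \<otimes>\<^bsub>D\<^esub> snd (\<phi> (g', \<one>\<^bsub>D\<^esub>))"
      using hom_mult[OF hom, of "(g, \<one>\<^bsub>D\<^esub>)" "(g', \<one>\<^bsub>D\<^esub>)"] g by (simp add: mult_DirProd')
    then show "twist \<phi> \<one>\<^bsub>D\<^esub> (g \<otimes>\<^bsub>G\<^esub> g') = twist \<phi> \<one>\<^bsub>D\<^esub> g \<otimes>\<^bsub>H\<^esub> twist \<phi> \<one>\<^bsub>D\<^esub> g'"
      using hom_mult[OF hom, of "(g, snd (\<phi> (g, \<one>\<^bsub>D\<^esub>)))" "(g', snd (\<phi> (g', \<one>\<^bsub>D\<^esub>)))"] g cl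
      by (simp add: mult_DirProd' twist_def)
  qed
qed

lemma iso_by_inverse:
  assumes "\<phi> \<in> hom G H" "\<psi> \<in> H' \<rightarrow> carrier G" "H' = carrier H"
    and "\<And>x. x \<in> carrier G \<Longrightarrow> \<psi> (\<phi> x) = x" "\<And>y. y \<in> carrier H \<Longrightarrow> \<phi> (\<psi> y) = y"
  shows "\<phi> \<in> iso G H"
  using assms unfolding iso_def hom_def
  by (auto intro!: bij_betw_byWitness[where f' = \<psi>])

text \<open>An isomorphism and its inverse fall on the same side of the dichotomy in
  \<open>snd_factor_trivial\<close>, and on either side their twists are inverse to each
  other.\<close>

lemma direct_factor_cancel:
  assumes G: "group G" and H: "group H" and D: "group D"
    and ind: "commuting_indecomposable D" and nontriv: "carrier D \<noteq> {\<one>\<^bsub>D\<^esub>}"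
    and iso: "G \<times>\<times> D \<cong> H \<times>\<times> D"
  shows "G \<cong> H"
proof -
  interpret G: group G by fact
  interpret H: group H by fact
  interpret D: group D by fact
  interpret GD: group "G \<times>\<times> D" by (rule DirProd_group[OF G D])
  obtain \<phi> where \<phi>: "\<phi> \<in> iso (G \<times>\<times> D) (H \<times>\<times> D)" using iso unfolding is_iso_def by blast
  define \<psi> where "\<psi> = inv_into (carrier (G \<times>\<times> D)) \<phi>"
  have \<psi>: "\<psi> \<in> iso (H \<times>\<times> D) (G \<times>\<times> D)" unfolding \<psi>_def by (rule GD.iso_set_sym[OF \<phi>])
  have bij: "bij_betw \<phi> (carrier (G \<times>\<times> D)) (carrier (H \<times>\<times> D))"
      "bij_betw \<psi> (carrier (H \<times>\<times> D)) (carrier (G \<times>\<times> D))"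
    using \<phi> \<psi> by (auto simp: iso_def)
  have hom: "\<phi> \<in> hom (G \<times>\<times> D) (H \<times>\<times> D)" "\<psi> \<in> hom (H \<times>\<times> D) (G \<times>\<times> D)"
    using \<phi> \<psi> by (auto simp: iso_def)
  have inv: "\<psi> (\<phi> x) = x" if "x \<in> carrier (G \<times>\<times> D)" for x
    using bij(1) that unfolding \<psi>_def by (rule bij_betw_inv_into_left)
  have inv': "\<phi> (\<psi> x) = x" if "x \<in> carrier (H \<times>\<times> D)" for x
    using bij(1) that unfolding \<psi>_def by (rule bij_betw_inv_into_right)
  obtain d where d: "d \<in> carrier D" "d \<noteq> \<one>\<^bsub>D\<^esub>" using nontriv by blast
  \<comment> \<open>If \<open>f\<close> moves \<open>D\<close> into the first factor and
    \<open>k\<close> keeps the first factor in place, then \<open>k (f (\<one>, d))\<close> has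
    trivial second component although it equals \<open>(\<one>, d)\<close>. The maps are arbitrary
    because both orders of \<open>\<phi>\<close> and \<open>\<psi>\<close> must be excluded.\<close>
  have mixed: False
    if a: "\<forall>d\<in>carrier D. snd (f (\<one>\<^bsub>K\<^esub>, d)) = \<one>\<^bsub>D\<^esub>" and b: "\<forall>h\<in>carrier L. snd (k (h, \<one>\<^bsub>D\<^esub>)) = \<one>\<^bsub>D\<^esub>"
      and f: "f \<in> hom (K \<times>\<times> D) (L \<times>\<times> D)" and kf: "\<And>x. x \<in> carrier (K \<times>\<times> D) \<Longrightarrow> k (f x) = x"
      and K: "group K"
    for f k and K :: "('x, 'y) monoid_scheme" and L :: "('z, 'w) monoid_scheme"
  proof -
    have o: "\<one>\<^bsub>K\<^esub> \<in> carrier K" using K by (simp add: group.is_monoid)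
    have "f (\<one>\<^bsub>K\<^esub>, d) = (fst (f (\<one>\<^bsub>K\<^esub>, d)), \<one>\<^bsub>D\<^esub>)" "fst (f (\<one>\<^bsub>K\<^esub>, d)) \<in> carrier L"
      using a d hom_in_carrier[OF f, of "(\<one>\<^bsub>K\<^esub>, d)"] o by (auto simp: prod_eq_iff)
    then have "snd (k (f (\<one>\<^bsub>K\<^esub>, d))) = \<one>\<^bsub>D\<^esub>" using b by metis
    then show False using kf[of "(\<one>\<^bsub>K\<^esub>, d)"] d o by simp
  qed
  note dich = snd_factor_trivial[OF H G D ind hom(1)] snd_factor_trivial[OF G H D ind hom(2)]
  have "(\<forall>d\<in>carrier D. snd (\<phi> (\<one>\<^bsub>G\<^esub>, d)) = \<one>\<^bsub>D\<^esub>) \<and> (\<forall>d\<in>carrier D. snd (\<psi> (\<one>\<^bsub>H\<^esub>, d)) = \<one>\<^bsub>D\<^esub>) \<or>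
     (\<forall>g\<in>carrier G. snd (\<phi> (g, \<one>\<^bsub>D\<^esub>)) = \<one>\<^bsub>D\<^esub>) \<and> (\<forall>h\<in>carrier H. snd (\<psi> (h, \<one>\<^bsub>D\<^esub>)) = \<one>\<^bsub>D\<^esub>)"
    using dich mixed[of \<phi> G H \<psi>, OF _ _ hom(1) inv G] mixed[of \<psi> H G \<phi>, OF _ _ hom(2) inv' H]
      bij by (auto simp: bij_betw_def)
  then have tw: "\<And>g. g \<in> carrier G \<Longrightarrow> twist \<psi> \<one>\<^bsub>D\<^esub> (twist \<phi> \<one>\<^bsub>D\<^esub> g) = g"
      "\<And>h. h \<in> carrier H \<Longrightarrow> twist \<phi> \<one>\<^bsub>D\<^esub> (twist \<psi> \<one>\<^bsub>D\<^esub> h) = h"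
    using twist_left_inverse[OF G H D hom inv] twist_left_inverse[OF H G D hom(2,1) inv'] by blast+
  have "twist \<phi> \<one>\<^bsub>D\<^esub> \<in> iso G H"
    by (rule iso_by_inverse[OF twist_hom[OF G H D hom(1)] _ _ tw])
      (use twist_hom[OF H G D hom(2)] in \<open>auto simp: hom_def\<close>)
  then show ?thesis unfolding is_iso_def by blast
qed

section \<open>The infinite dihedral group\<close>

text \<open>The pair \<open>(n, e)\<close> stands for the isometry \<open>t \<mapsto> n + t\<close> or \<open>t \<mapsto> n - t\<close> of the integers,
according to whether \<open>e\<close> is false or true.\<close>

definition inf_dihedral :: "(int \<times> bool) monoid" where
  "inf_dihedral = \<lparr> carrier = UNIV,
     mult = (\<lambda>(m, e) (n, f). (m + (if e then - n else n), e \<noteq> f)), one = (0, False) \<rparr>"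

lemma inf_dihedral_simps [simp]:
  "carrier inf_dihedral = UNIV"
  "(m, e) \<otimes>\<^bsub>inf_dihedral\<^esub> (n, f) = (m + (if e then - n else n), e \<noteq> f)"
  "\<one>\<^bsub>inf_dihedral\<^esub> = (0, False)"
  by (simp_all add: inf_dihedral_def)

lemma group_inf_dihedral: "group inf_dihedral"
proof (rule groupI)
  fix x :: "int \<times> bool"
  obtain m e where "x = (m, e)" by fastforce
  then have "((if e then m else - m), e) \<otimes>\<^bsub>inf_dihedral\<^esub> x = \<one>\<^bsub>inf_dihedral\<^esub>" by simp
  then show "\<exists>y\<in>carrier inf_dihedral. y \<otimes>\<^bsub>inf_dihedral\<^esub> x = \<one>\<^bsub>inf_dihedral\<^esub>" by fastforce
qed auto

text \<open>A reflection occurs in one of the two commuting factors, and it commutes only with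
itself and the identity.\<close>

lemma commuting_indecomposable_inf_dihedral: "commuting_indecomposable inf_dihedral"
  unfolding commuting_indecomposable_def
proof (intro allI impI)
  fix A B :: "(int \<times> bool) set"
  assume comm: "\<forall>a\<in>A. \<forall>b\<in>B. a \<otimes>\<^bsub>inf_dihedral\<^esub> b = b \<otimes>\<^bsub>inf_dihedral\<^esub> a"
    and gen: "\<forall>x\<in>carrier inf_dihedral. \<exists>a\<in>A. \<exists>b\<in>B. x = a \<otimes>\<^bsub>inf_dihedral\<^esub> b"
  have cent: "x = (0, False) \<or> x = (n, True)"
    if "(n, True) \<otimes>\<^bsub>inf_dihedral\<^esub> x = x \<otimes>\<^bsub>inf_dihedral\<^esub> (n, True)" for n x
    using that by (cases x) (auto split: if_splits)
  have main: "Y \<subseteq> {(0, False)}"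
    if r: "(n, True) \<in> X" and c: "\<forall>a\<in>X. \<forall>b\<in>Y. a \<otimes>\<^bsub>inf_dihedral\<^esub> b = b \<otimes>\<^bsub>inf_dihedral\<^esub> a"
      and g: "\<forall>x. \<exists>a\<in>X. \<exists>b\<in>Y. x = a \<otimes>\<^bsub>inf_dihedral\<^esub> b" for X Y n
  proof (rule ccontr)
    assume ne: "\<not> Y \<subseteq> {(0, False)}"
    \<comment> \<open>A nontrivial \<open>Y\<close> contains the reflection itself and so confines
      \<open>X\<close> to the same subgroup of order two. Products then stay in that subgroup, which
      misses the different reflection \<open>(n + 1, True)\<close>.\<close>
    have Y: "Y \<subseteq> {(0, False), (n, True)}" using r c cent by blast
    then have "(n, True) \<in> Y" using ne by blast
    then have "X \<subseteq> {(0, False), (n, True)}" using c cent by (metis insert_iff subsetI)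
    moreover obtain a b where "a \<in> X" "b \<in> Y" "(n + 1, True) = a \<otimes>\<^bsub>inf_dihedral\<^esub> b" using g by blast
    ultimately have "a \<in> {(0, False), (n, True)}" "b \<in> {(0, False), (n, True)}"
      "(n + 1, True) = a \<otimes>\<^bsub>inf_dihedral\<^esub> b" using Y by blast+
    then show False by auto
  qed
  have gen': "\<forall>x. \<exists>a\<in>A. \<exists>b\<in>B. x = a \<otimes>\<^bsub>inf_dihedral\<^esub> b" using gen by simp
  obtain a b where ab: "a \<in> A" "b \<in> B" "(0, True) = a \<otimes>\<^bsub>inf_dihedral\<^esub> b" using gen' by blast
  obtain m e n f where mn: "a = (m, e)" "b = (n, f)" by fastforce
  \<comment> \<open>The flag of a product is \<open>e \<noteq> f\<close>, so a reflection needs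
    exactly one reflection among its factors.\<close>
  have "e \<or> f" using ab(3) by (auto simp: mn)
  then have "B \<subseteq> {(0, False)} \<or> A \<subseteq> {(0, False)}"
  proof
    assume e
    then have "(m, True) \<in> A" using ab mn by simp
    then show ?thesis using main[OF _ comm gen'] by blast
  next
    assume f
    then have r: "(n, True) \<in> B" using ab mn by simp
    have c: "\<forall>b\<in>B. \<forall>a\<in>A. b \<otimes>\<^bsub>inf_dihedral\<^esub> a = a \<otimes>\<^bsub>inf_dihedral\<^esub> b" using comm by metis
    have "\<exists>b\<in>B. \<exists>a\<in>A. x = b \<otimes>\<^bsub>inf_dihedral\<^esub> a" for x
    proof -
      obtain a b where "a \<in> A" "b \<in> B" "x = a \<otimes>\<^bsub>inf_dihedral\<^esub> b" using gen' by blast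
      then show ?thesis using c by metis
    qed
    then show ?thesis using main[OF r c] by blast
  qed
  then show "A \<subseteq> {\<one>\<^bsub>inf_dihedral\<^esub>} \<or> B \<subseteq> {\<one>\<^bsub>inf_dihedral\<^esub>}" by auto
qed

section \<open>Generators and the universal property of the infinite dihedral group\<close>

lemma hom_eq_on_generate:
  assumes G: "group G" and H: "group H" and h: "h \<in> hom G H" and k: "k \<in> hom G H"
    and S: "S \<subseteq> carrier G" "\<And>s. s \<in> S \<Longrightarrow> h s = k s" and x: "x \<in> generate G S"
  shows "h x = k x"
proof -
  interpret G: group G by fact
  interpret H: group H by fact
  interpret h: group_hom G H h using h by unfold_locales
  interpret k: group_hom G H k using k by unfold_locales
  show ?thesis using x
  proof (induction rule: generate.induct)
    case (inv s)
    then show ?case using S by (metis h.hom_inv k.hom_inv subsetD)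
  next
    case (eng x y)
    then show ?case using G.generate_in_carrier[OF S(1)] by simp
  qed (use S in auto)
qed

text \<open>The elements whose image centralises \<open>z\<close> form a subgroup. Two applications,
  one per factor, turn commuting generators into commuting images of two groups.\<close>

lemma commute_on_generate:
  assumes G: "group G" and H: "group H" and h: "h \<in> hom G H"
    and S: "S \<subseteq> carrier G" "\<And>s. s \<in> S \<Longrightarrow> h s \<otimes>\<^bsub>H\<^esub> z = z \<otimes>\<^bsub>H\<^esub> h s" and z: "z \<in> carrier H"
    and x: "x \<in> generate G S"
  shows "h x \<otimes>\<^bsub>H\<^esub> z = z \<otimes>\<^bsub>H\<^esub> h x"
proof -
  interpret G: group G by fact
  interpret H: group H by fact
  interpret h: group_hom G H h using h by unfold_locales
  show ?thesis using x
  proof (induction rule: generate.induct)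
    case (inv s)
    then have s: "s \<in> carrier G" "h s \<otimes>\<^bsub>H\<^esub> z = z \<otimes>\<^bsub>H\<^esub> h s" using S by auto
    have "z \<otimes>\<^bsub>H\<^esub> inv\<^bsub>H\<^esub> h s = inv\<^bsub>H\<^esub> h s \<otimes>\<^bsub>H\<^esub> (h s \<otimes>\<^bsub>H\<^esub> z) \<otimes>\<^bsub>H\<^esub> inv\<^bsub>H\<^esub> h s"
      using s(1) z by (simp add: H.m_assoc[symmetric])
    also have "\<dots> = inv\<^bsub>H\<^esub> h s \<otimes>\<^bsub>H\<^esub> z"
      unfolding s(2) using s(1) z by (simp add: H.m_assoc)
    finally have "inv\<^bsub>H\<^esub> h s \<otimes>\<^bsub>H\<^esub> z = z \<otimes>\<^bsub>H\<^esub> inv\<^bsub>H\<^esub> h s" ..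
    then show ?case using s(1) by simp
  next
    case (eng x y)
    then have c: "h x \<in> carrier H" "h y \<in> carrier H" "x \<in> carrier G" "y \<in> carrier G"
      using G.generate_in_carrier[OF S(1)] by auto
    have "h x \<otimes>\<^bsub>H\<^esub> h y \<otimes>\<^bsub>H\<^esub> z = z \<otimes>\<^bsub>H\<^esub> (h x \<otimes>\<^bsub>H\<^esub> h y)"
      using eng.IH c z by (metis H.m_assoc)
    then show ?case using c by simp
  qed (use S z in auto)
qed

lemma DirProd_nat_pow:
  fixes n :: nat
  shows "(x, y) [^]\<^bsub>G \<times>\<times> H\<^esub> n = (x [^]\<^bsub>G\<^esub> n, y [^]\<^bsub>H\<^esub> n)"
  by (induction n) (simp_all add: nat_pow_def)

text \<open>The normal form \<open>(n, e) = (1, False)^n (0, True)^e\<close>, with the reflections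
  \<open>(0, True)\<close> and \<open>(1, True)\<close> sent to \<open>x\<close> and
  \<open>y\<close>; the translation \<open>(1, False)\<close> is \<open>(1, True)\<close> times
  \<open>(0, True)\<close>, hence goes to \<open>y x\<close>.\<close>

definition dihedral_lift :: "('a, 'b) monoid_scheme \<Rightarrow> 'a \<Rightarrow> 'a \<Rightarrow> int \<times> bool \<Rightarrow> 'a" where
  "dihedral_lift G x y = (\<lambda>(n, e). (y \<otimes>\<^bsub>G\<^esub> x) [^]\<^bsub>G\<^esub> n \<otimes>\<^bsub>G\<^esub> (if e then x else \<one>\<^bsub>G\<^esub>))"

text \<open>The infinite dihedral group is the free product of two groups of order two. Everything
  rests on \<open>x r = r^-1 x\<close> for \<open>r = y x\<close>, extended to all integer powers of
  \<open>r\<close>.\<close>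

lemma dihedral_lift:
  assumes G: "group G" and x: "x \<in> carrier G" "x \<otimes>\<^bsub>G\<^esub> x = \<one>\<^bsub>G\<^esub>"
    and y: "y \<in> carrier G" "y \<otimes>\<^bsub>G\<^esub> y = \<one>\<^bsub>G\<^esub>"
  shows "dihedral_lift G x y \<in> hom inf_dihedral G" "dihedral_lift G x y (0, True) = x"
    "dihedral_lift G x y (1, True) = y"
proof -
  interpret group G by fact
  define r where "r = y \<otimes>\<^bsub>G\<^esub> x"
  have r: "r \<in> carrier G" using x y by (simp add: r_def)
  have xinv: "inv\<^bsub>G\<^esub> x = x" and yinv: "inv\<^bsub>G\<^esub> y = y" using x y inv_equality by auto
  have rinv: "inv\<^bsub>G\<^esub> r = x \<otimes>\<^bsub>G\<^esub> y" using x y xinv yinv by (simp add: r_def inv_mult_group)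
  have xr: "x \<otimes>\<^bsub>G\<^esub> r = inv\<^bsub>G\<^esub> r \<otimes>\<^bsub>G\<^esub> x"
    unfolding rinv using x y by (simp add: r_def m_assoc)
  have xrn: "x \<otimes>\<^bsub>G\<^esub> r [^]\<^bsub>G\<^esub> n = inv\<^bsub>G\<^esub> (r [^]\<^bsub>G\<^esub> n) \<otimes>\<^bsub>G\<^esub> x" for n :: nat
  proof (induction n)
    case 0
    then show ?case using x by simp
  next
    case (Suc n)
    have "x \<otimes>\<^bsub>G\<^esub> r [^]\<^bsub>G\<^esub> Suc n = (x \<otimes>\<^bsub>G\<^esub> r [^]\<^bsub>G\<^esub> n) \<otimes>\<^bsub>G\<^esub> r" using x r by (simp add: m_assoc)
    also have "\<dots> = inv\<^bsub>G\<^esub> (r [^]\<^bsub>G\<^esub> n) \<otimes>\<^bsub>G\<^esub> (x \<otimes>\<^bsub>G\<^esub> r)" using Suc x r by (simp add: m_assoc)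
    also have "\<dots> = inv\<^bsub>G\<^esub> (r [^]\<^bsub>G\<^esub> n) \<otimes>\<^bsub>G\<^esub> inv\<^bsub>G\<^esub> r \<otimes>\<^bsub>G\<^esub> x" using xr x r by (simp add: m_assoc)
    also have "\<dots> = inv\<^bsub>G\<^esub> (r [^]\<^bsub>G\<^esub> Suc n) \<otimes>\<^bsub>G\<^esub> x"
      unfolding nat_pow_Suc2[OF r] using r by (simp add: inv_mult_group)
    finally show ?case .
  qed
  \<comment> \<open>Multiplying the relation for \<open>s\<close> by \<open>x\<close> on both sides
    gives the relation for its inverse, which covers negative exponents.\<close>
  have xinv_r: "x \<otimes>\<^bsub>G\<^esub> inv\<^bsub>G\<^esub> s = s \<otimes>\<^bsub>G\<^esub> x" if s: "s \<in> carrier G" "x \<otimes>\<^bsub>G\<^esub> s = inv\<^bsub>G\<^esub> s \<otimes>\<^bsub>G\<^esub> x" for s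
  proof -
    have "inv\<^bsub>G\<^esub> (x \<otimes>\<^bsub>G\<^esub> s) = inv\<^bsub>G\<^esub> (inv\<^bsub>G\<^esub> s \<otimes>\<^bsub>G\<^esub> x)" using s(2) by simp
    then have e: "inv\<^bsub>G\<^esub> s \<otimes>\<^bsub>G\<^esub> x = x \<otimes>\<^bsub>G\<^esub> s" using s(1) x by (simp add: inv_mult_group xinv)
    have "x \<otimes>\<^bsub>G\<^esub> (inv\<^bsub>G\<^esub> s \<otimes>\<^bsub>G\<^esub> x) \<otimes>\<^bsub>G\<^esub> x = x \<otimes>\<^bsub>G\<^esub> (x \<otimes>\<^bsub>G\<^esub> s) \<otimes>\<^bsub>G\<^esub> x" using e by simp
    moreover have "x \<otimes>\<^bsub>G\<^esub> (x \<otimes>\<^bsub>G\<^esub> t) = t" if "t \<in> carrier G" for t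
      using x that by (simp add: m_assoc[symmetric])
    ultimately show ?thesis using s(1) x by (simp add: m_assoc)
  qed
  have xrz: "x \<otimes>\<^bsub>G\<^esub> r [^]\<^bsub>G\<^esub> n = r [^]\<^bsub>G\<^esub> (- n) \<otimes>\<^bsub>G\<^esub> x" for n :: int
  proof (cases n rule: int_cases2)
    case (nonneg k)
    then show ?thesis using xrn[of k] r by (simp add: int_pow_neg int_pow_int)
  next
    case (nonpos k)
    then show ?thesis using xinv_r[OF _ xrn[of k]] r by (simp add: int_pow_neg int_pow_int)
  qed
  have lift: "dihedral_lift G x y (n, e) = r [^]\<^bsub>G\<^esub> n \<otimes>\<^bsub>G\<^esub> (if e then x else \<one>\<^bsub>G\<^esub>)" for n e
    by (simp add: dihedral_lift_def r_def)
  show "dihedral_lift G x y \<in> hom inf_dihedral G"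
  proof (rule homI)
    fix p :: "int \<times> bool"
    show "dihedral_lift G x y p \<in> carrier G" using r x by (cases p) (simp add: lift)
  next
    fix p q :: "int \<times> bool"
    obtain m e n f where pq: "p = (m, e)" "q = (n, f)" by fastforce
    let ?f = "if f then x else \<one>\<^bsub>G\<^esub>"
    have f: "?f \<in> carrier G" using x by simp
    show "dihedral_lift G x y (p \<otimes>\<^bsub>inf_dihedral\<^esub> q) = dihedral_lift G x y p \<otimes>\<^bsub>G\<^esub> dihedral_lift G x y q"
    proof (cases e)
      case True
      \<comment> \<open>Moving \<open>x\<close> to the right past \<open>r [^] n\<close> changes the
        sign of \<open>n\<close>, which is the sign in the multiplication of
        \<open>inf_dihedral\<close>.\<close>
      have "dihedral_lift G x y p \<otimes>\<^bsub>G\<^esub> dihedral_lift G x y q = r [^]\<^bsub>G\<^esub> m \<otimes>\<^bsub>G\<^esub> (x \<otimes>\<^bsub>G\<^esub> r [^]\<^bsub>G\<^esub> n) \<otimes>\<^bsub>G\<^esub> ?f"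
        using True r x f by (simp add: pq lift m_assoc)
      also have "\<dots> = r [^]\<^bsub>G\<^esub> (m - n) \<otimes>\<^bsub>G\<^esub> (x \<otimes>\<^bsub>G\<^esub> ?f)"
        unfolding xrz using r x f int_pow_mult[OF r, of m "- n"] by (simp add: m_assoc)
      finally show ?thesis using True x r by (simp add: pq lift)
    next
      case False
      then show ?thesis using r x f by (simp add: pq lift m_assoc[symmetric] int_pow_mult)
    qed
  qed
  show "dihedral_lift G x y (0, True) = x" using x by (simp add: lift)
  show "dihedral_lift G x y (1, True) = y" using x y r by (simp add: lift int_pow_1) (simp add: r_def m_assoc)
qed

text \<open>The two reflections multiplied in the two orders are the translations by 1 and by -1;
  every reflection is a translation times \<open>(0, True)\<close>.\<close>

lemma generate_inf_dihedral: "generate inf_dihedral {(0, True), (1, True)} = UNIV"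
proof -
  let ?g = "generate inf_dihedral {(0, True), (1, True)}"
  have a: "(0, True) \<in> ?g" and b: "(1, True) \<in> ?g" by (auto intro: generate.incl)
  have up: "(1, False) \<in> ?g" using generate.eng[OF b a] by simp
  have down: "(-1, False) \<in> ?g" using generate.eng[OF a b] by simp
  have r: "(n, False) \<in> ?g" for n
  proof (induction n rule: int_induct[where k = 0])
    case base
    then show ?case using generate.one[of inf_dihedral] by simp
  next
    case (step1 i)
    then show ?case using generate.eng[OF step1(2) up] by simp
  next
    case (step2 i)
    then show ?case using generate.eng[OF step2(2) down] by simp
  qed
  have "(n, e) \<in> ?g" for n e using r[of n] generate.eng[OF r[of n] a] by (cases e) auto
  then show ?thesis by auto
qed

section \<open>Ends of products\<close>

lemma cayley_step_sym:
  assumes "group G" "S \<subseteq> carrier G" "(g, h) \<in> cayley_step G S K"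
  shows "(h, g) \<in> cayley_step G S K"
proof -
  interpret group G by fact
  from assms(3) obtain s where s: "s \<in> S" "g \<in> carrier G" "g \<notin> K" "h \<notin> K"
      and h: "h = g \<otimes>\<^bsub>G\<^esub> s \<or> h = g \<otimes>\<^bsub>G\<^esub> inv\<^bsub>G\<^esub> s" by (auto simp: cayley_step_def)
  have "s \<in> carrier G" using s assms(2) by auto
  then have "h \<in> carrier G \<and> (g = h \<otimes>\<^bsub>G\<^esub> s \<or> g = h \<otimes>\<^bsub>G\<^esub> inv\<^bsub>G\<^esub> s)" using h s
    by (auto simp: m_assoc)
  then show ?thesis using s by (auto simp: cayley_step_def)
qed

text \<open>An infinite component cannot be contained in the finite set \<open>L\<close>, and all
  points outside \<open>L\<close> lie in one component. \<open>L\<close> may exceed \<open>K\<close>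
  because removing \<open>K\<close> can cut off finite pockets, which are not counted as
  ends.\<close>

lemma one_endedI:
  assumes G: "group G" and S: "S \<subseteq> carrier G" and inf: "infinite (carrier G)"
    and conn: "\<And>K. K \<subseteq> carrier G \<Longrightarrow> finite K \<Longrightarrow> \<exists>L. finite L \<and> K \<subseteq> L \<and>
      (\<forall>g\<in>carrier G - L. \<forall>h\<in>carrier G - L. (g, h) \<in> (cayley_step G S K)\<^sup>*)"
  shows "one_ended G S"
  unfolding one_ended_def
proof (intro conjI inf allI impI, elim conjE)
  fix K assume K: "K \<subseteq> carrier G" "finite K"
  let ?R = "(cayley_step G S K)\<^sup>*"
  obtain L where L: "finite L" "K \<subseteq> L"
    and c: "\<And>g h. g \<in> carrier G - L \<Longrightarrow> h \<in> carrier G - L \<Longrightarrow> (g, h) \<in> ?R"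
    using conn[OF K] by blast
  have "sym (cayley_step G S K)" using cayley_step_sym[OF G S] by (auto intro: symI)
  then have sym: "(h, g) \<in> ?R" if "(g, h) \<in> ?R" for g h
    using that by (meson sym_rtrancl symD)
  obtain g0 where g0: "g0 \<in> carrier G - L" 
    using infinite_imp_nonempty[OF Diff_infinite_finite[OF L(1) inf]] by blast
  have "carrier G - L \<subseteq> cayley_component G S K g0"
    using c[OF g0] by (auto simp: cayley_component_def)
  then have inf0: "infinite (cayley_component G S K g0)"
    using inf L(1) by (meson Diff_infinite_finite finite_subset)
  have "{C. \<exists>g\<in>carrier G - K. C = cayley_component G S K g \<and> infinite C} = {cayley_component G S K g0}"
  proof safe
    fix g assume g: "g \<in> carrier G" "g \<notin> K" and i: "infinite (cayley_component G S K g)"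
    interpret group G by fact
    have "cayley_component G S K g \<subseteq> carrier G"
    proof
      fix h assume "h \<in> cayley_component G S K g"
      then have "(g, h) \<in> ?R" by (simp add: cayley_component_def)
      then show "h \<in> carrier G"
        by (induction rule: rtrancl_induct) (use g S in \<open>auto simp: cayley_step_def\<close>)
    qed
    moreover have "\<not> cayley_component G S K g \<subseteq> L" using i L(1) finite_subset by blast
    ultimately obtain h where h: "(g, h) \<in> ?R" "h \<in> carrier G - L"
      unfolding cayley_component_def by blast
    have "(g, g0) \<in> ?R" using h(1) c[OF h(2) g0] by (rule rtrancl_trans)
    then have eq: "(g, x) \<in> ?R \<longleftrightarrow> (g0, x) \<in> ?R" for x using sym by (meson rtrancl_trans)
    then show "x \<in> cayley_component G S K g0" if "x \<in> cayley_component G S K g" for x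
      using that by (simp add: cayley_component_def)
    show "x \<in> cayley_component G S K g" if "x \<in> cayley_component G S K g0" for x
      using that eq by (simp add: cayley_component_def)
  next
    show "\<exists>g\<in>carrier G - K. cayley_component G S K g0 = cayley_component G S K g \<and>
        infinite (cayley_component G S K g0)" using g0 L inf0 by blast
  qed
  then show "card {C. \<exists>g\<in>carrier G - K. C = cayley_component G S K g \<and> infinite C} = 1" by simp
qed

text \<open>Writing \<open>x\<close> as a word in \<open>T\<close> gives a path from
  \<open>a\<close> whose vertices all lie in the coset \<open>a \<iota>(H)\<close>; if this coset
  misses \<open>K\<close>, so does the path.\<close>

lemma cayley_path_generate:
  assumes A: "group A" and H: "group H" and S: "S \<subseteq> carrier A" and T: "T \<subseteq> carrier H"
    and \<iota>: "\<iota> \<in> hom H A" "\<iota> ` T \<subseteq> S" and x: "x \<in> generate H T" and a: "a \<in> carrier A"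
    and avoid: "\<And>h. h \<in> carrier H \<Longrightarrow> a \<otimes>\<^bsub>A\<^esub> \<iota> h \<notin> K"
  shows "(a, a \<otimes>\<^bsub>A\<^esub> \<iota> x) \<in> (cayley_step A S K)\<^sup>*"
proof -
  interpret A: group A by fact
  interpret H: group H by fact
  interpret group_hom H A \<iota> using \<iota>(1) by unfold_locales
  show ?thesis using x a avoid
  proof (induction arbitrary: a rule: generate.induct)
    case one
    then show ?case by simp
  next
    case (incl h)
    have h: "h \<in> carrier H" using incl T by auto
    have "a \<notin> K" using incl.prems(2)[of "\<one>\<^bsub>H\<^esub>"] incl.prems(1) by simp
    then have "(a, a \<otimes>\<^bsub>A\<^esub> \<iota> h) \<in> cayley_step A S K"
      using incl \<iota>(2) h by (auto simp: cayley_step_def)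
    then show ?case by blast
  next
    case (inv h)
    have h: "h \<in> carrier H" using inv T by auto
    have "a \<notin> K" using inv.prems(2)[of "\<one>\<^bsub>H\<^esub>"] inv.prems(1) by simp
    moreover have "a \<otimes>\<^bsub>A\<^esub> inv\<^bsub>A\<^esub> \<iota> h \<notin> K" using inv.prems(2)[of "inv\<^bsub>H\<^esub> h"] h by simp
    ultimately have "(a, a \<otimes>\<^bsub>A\<^esub> inv\<^bsub>A\<^esub> \<iota> h) \<in> cayley_step A S K"
      using inv \<iota>(2) h by (auto simp: cayley_step_def)
    then show ?case using h by auto
  next
    case (eng x y)
    have xy: "x \<in> carrier H" "y \<in> carrier H"
      using eng T H.generate_in_carrier by blast+
    have "(a, a \<otimes>\<^bsub>A\<^esub> \<iota> x) \<in> (cayley_step A S K)\<^sup>*" using eng by blast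
    moreover have "(a \<otimes>\<^bsub>A\<^esub> \<iota> x, a \<otimes>\<^bsub>A\<^esub> \<iota> x \<otimes>\<^bsub>A\<^esub> \<iota> y) \<in> (cayley_step A S K)\<^sup>*"
    proof (rule eng.IH(2))
      \<comment> \<open>Starting from \<open>a \<iota>(x)\<close> instead of \<open>a\<close> does
        not change the coset, so the second half of the path avoids \<open>K\<close> as
        well.\<close>
      show "a \<otimes>\<^bsub>A\<^esub> \<iota> x \<otimes>\<^bsub>A\<^esub> \<iota> h \<notin> K" if "h \<in> carrier H" for h
        using eng.prems(2)[of "x \<otimes>\<^bsub>H\<^esub> h"] eng.prems(1) that xy by (simp add: A.m_assoc)
    qed (use eng xy in auto)
    ultimately show ?case using eng.prems xy by (simp add: A.m_assoc)
  qed
qed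

text \<open>Outside a finite box, any two points of a product of infinite groups are joined by
moving along a horizontal and a vertical line that both miss the box.\<close>

lemma one_ended_product:
  assumes A: "group A" and G: "group G" and H: "group H"
    and iso: "\<phi> \<in> iso A (G \<times>\<times> H)" and S: "S \<subseteq> carrier A"
    and S1: "S1 \<subseteq> carrier G" "generate G S1 = carrier G"
    and S2: "S2 \<subseteq> carrier H" "generate H S2 = carrier H"
    and sub: "S1 \<times> {\<one>\<^bsub>H\<^esub>} \<subseteq> \<phi> ` S" "{\<one>\<^bsub>G\<^esub>} \<times> S2 \<subseteq> \<phi> ` S"
    and inf: "infinite (carrier G)" "infinite (carrier H)"
  shows "one_ended A S"
proof (rule one_endedI[OF A S])
  interpret A: group A by fact
  interpret G: group G by fact
  interpret H: group H by fact
  interpret GH: group "G \<times>\<times> H" by (rule DirProd_group[OF G H])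
  have bij: "bij_betw \<phi> (carrier A) (carrier G \<times> carrier H)" using iso by (auto simp: iso_def)
  have inj: "inj_on \<phi> (carrier A)" using bij by (simp add: bij_betw_def)
  have infGH: "infinite (carrier G \<times> carrier H)"
    using inf finite_cartesian_productD1 by (metis G.one_closed H.one_closed empty_iff)
  then show "infinite (carrier A)" using bij bij_betw_finite by blast
  define \<psi> where "\<psi> = inv_into (carrier A) \<phi>"
  have \<psi>: "\<psi> \<in> hom (G \<times>\<times> H) A" using A.iso_set_sym[OF iso] by (simp add: \<psi>_def iso_def)
  have \<psi>\<phi>: "\<psi> (\<phi> a) = a" if "a \<in> carrier A" for a
    using that inj by (simp add: \<psi>_def)
  have \<phi>\<psi>: "\<phi> (\<psi> (g, h)) = (g, h)" if "g \<in> carrier G" "h \<in> carrier H" for g h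
    using bij that by (auto simp: \<psi>_def bij_betw_def intro!: f_inv_into_f)
  have \<psi>cl: "\<psi> (g, h) \<in> carrier A" if "g \<in> carrier G" "h \<in> carrier H" for g h
    using hom_in_carrier[OF \<psi>] that by simp
  have sub': "\<psi> ` (S1 \<times> {\<one>\<^bsub>H\<^esub>}) \<subseteq> S" "\<psi> ` ({\<one>\<^bsub>G\<^esub>} \<times> S2) \<subseteq> S"
    using image_mono[OF sub(1), of \<psi>] image_mono[OF sub(2), of \<psi>] \<psi>\<phi> S
    by (force simp: image_image subset_iff image_iff)+
  have hom1: "(\<lambda>g. \<psi> (g, \<one>\<^bsub>H\<^esub>)) \<in> hom G A" and hom2: "(\<lambda>h. \<psi> (\<one>\<^bsub>G\<^esub>, h)) \<in> hom H A"
    using hom_mult[OF \<psi>] \<psi>cl by (auto intro!: homI simp flip: hom_mult[OF \<psi>])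
  have mult: "\<psi> (g, h) \<otimes>\<^bsub>A\<^esub> \<psi> (g', h') = \<psi> (g \<otimes>\<^bsub>G\<^esub> g', h \<otimes>\<^bsub>H\<^esub> h')"
    if "g \<in> carrier G" "h \<in> carrier H" "g' \<in> carrier G" "h' \<in> carrier H" for g h g' h'
    using hom_mult[OF \<psi>, of "(g, h)" "(g', h')"] that by simp
  fix K assume K: "K \<subseteq> carrier A" "finite K"
  let ?R = "(cayley_step A S K)\<^sup>*"
  \<comment> \<open>The finite coordinate shadows of \<open>K\<close>: a line whose fixed coordinate
    lies outside its shadow misses \<open>K\<close> entirely.\<close>
  define K1 K2 where "K1 = fst ` \<phi> ` K" and "K2 = snd ` \<phi> ` K"
  have fin: "finite K1" "finite K2" using K by (auto simp: K1_def K2_def)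
  have notK: "\<psi> (g, h) \<notin> K" if "g \<in> carrier G" "h \<in> carrier H" "g \<notin> K1 \<or> h \<notin> K2" for g h
  proof
    assume "\<psi> (g, h) \<in> K"
    then have "(g, h) \<in> \<phi> ` K" using \<phi>\<psi>[OF that(1,2)] by (metis imageI)
    then show False using that(3) unfolding K1_def K2_def by (metis fst_conv imageI snd_conv)
  qed
  have vert: "(\<psi> (g, h), \<psi> (g, h')) \<in> ?R"
    if "g \<in> carrier G" "g \<notin> K1" "h \<in> carrier H" "h' \<in> carrier H" for g h h'
  proof -
    have "(\<psi> (g, h), \<psi> (g, h) \<otimes>\<^bsub>A\<^esub> \<psi> (\<one>\<^bsub>G\<^esub>, inv\<^bsub>H\<^esub> h \<otimes>\<^bsub>H\<^esub> h')) \<in> ?R"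
      by (rule cayley_path_generate[OF A H S S2(1) hom2])
        (use that sub' S2 notK in \<open>auto simp: mult \<psi>cl\<close>)
    then show ?thesis using that by (simp add: mult H.m_assoc[symmetric])
  qed
  have horiz: "(\<psi> (g, h), \<psi> (g', h)) \<in> ?R"
    if "h \<in> carrier H" "h \<notin> K2" "g \<in> carrier G" "g' \<in> carrier G" for g g' h
  proof -
    have "(\<psi> (g, h), \<psi> (g, h) \<otimes>\<^bsub>A\<^esub> \<psi> (inv\<^bsub>G\<^esub> g \<otimes>\<^bsub>G\<^esub> g', \<one>\<^bsub>H\<^esub>)) \<in> ?R"
      by (rule cayley_path_generate[OF A G S S1(1) hom1])
        (use that sub' S1 notK in \<open>auto simp: mult \<psi>cl\<close>)
    then show ?thesis using that by (simp add: mult G.m_assoc[symmetric])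
  qed
  obtain g0 where g0: "g0 \<in> carrier G" "g0 \<notin> K1" using inf(1) fin by (meson finite_subset subsetI)
  obtain h0 where h0: "h0 \<in> carrier H" "h0 \<notin> K2" using inf(2) fin by (meson finite_subset subsetI)
  define L where "L = \<psi> ` ((K1 \<times> K2) \<inter> (carrier G \<times> carrier H))"
  \<comment> \<open>The corner \<open>(g0, h0)\<close> lies outside both shadows. If
    \<open>g\<close> is outside \<open>K1\<close>, the route to it passes through
    \<open>(g, h0)\<close>; if \<open>h\<close> is outside \<open>K2\<close>, through
    \<open>(g0, h)\<close>.\<close>
  have hub: "(\<psi> (g, h), \<psi> (g0, h0)) \<in> ?R \<and> (\<psi> (g0, h0), \<psi> (g, h)) \<in> ?R"
    if gh: "g \<in> carrier G" "h \<in> carrier H" "g \<notin> K1 \<or> h \<notin> K2" for g h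
    using gh(3)
  proof
    assume "g \<notin> K1"
    then show ?thesis using vert[of g h h0] vert[of g h0 h] horiz[of h0 g g0] horiz[of h0 g0 g] gh g0 h0
      by (meson rtrancl_trans)
  next
    assume "h \<notin> K2"
    then show ?thesis using horiz[of h g g0] horiz[of h g0 g] vert[of g0 h h0] vert[of g0 h0 h] gh g0 h0
      by (meson rtrancl_trans)
  qed
  have repr: "\<exists>g h. a = \<psi> (g, h) \<and> g \<in> carrier G \<and> h \<in> carrier H \<and> \<phi> a = (g, h)" if "a \<in> carrier A" for a
    using bij that \<psi>\<phi>[OF that] by (metis SigmaE bij_betwE)
  show "\<exists>L. finite L \<and> K \<subseteq> L \<and> (\<forall>g\<in>carrier A - L. \<forall>h\<in>carrier A - L. (g, h) \<in> ?R)"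
  proof (intro exI conjI ballI)
    show "finite L" using fin by (simp add: L_def)
    show "K \<subseteq> L"
    proof
      fix a assume a: "a \<in> K"
      then obtain g h where gh: "a = \<psi> (g, h)" "g \<in> carrier G" "h \<in> carrier H" "\<phi> a = (g, h)"
        using repr K by blast
      have "g \<in> K1" "h \<in> K2" using a gh(4) unfolding K1_def K2_def by force+
      then show "a \<in> L" using gh by (auto simp: L_def)
    qed
  next
    fix a b assume ab: "a \<in> carrier A - L" "b \<in> carrier A - L"
    then obtain g h g' h' where "a = \<psi> (g, h)" "g \<in> carrier G" "h \<in> carrier H"
        "b = \<psi> (g', h')" "g' \<in> carrier G" "h' \<in> carrier H" using repr by (metis DiffD1)
    moreover from this have "g \<notin> K1 \<or> h \<notin> K2" "g' \<notin> K1 \<or> h' \<notin> K2" using ab by (auto simp: L_def)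
    ultimately show "(a, b) \<in> ?R" using hub by (meson rtrancl_trans)
  qed
qed

section \<open>Profinite completions\<close>

text \<open>On \<open>X\<close> the function \<open>f\<close> factors through \<open>g\<close>. This
  transfers finite index to preimages and intersections, and at the very end finiteness of a set of
  isomorphism classes.\<close>

lemma finite_image_factor:
  assumes "finite (g ` X)" "\<And>x y. x \<in> X \<Longrightarrow> y \<in> X \<Longrightarrow> g x = g y \<Longrightarrow> f x = f y"
  shows "finite (f ` X)"
proof -
  have "f ` X \<subseteq> (\<lambda>c. f (SOME x. x \<in> X \<and> g x = c)) ` (g ` X)"
  proof
    fix y assume "y \<in> f ` X"
    then obtain x where x: "x \<in> X" "y = f x" by blast
    have "(SOME z. z \<in> X \<and> g z = g x) \<in> X \<and> g (SOME z. z \<in> X \<and> g z = g x) = g x"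
      by (rule someI[of _ x]) (use x in simp)
    then have "y = f (SOME z. z \<in> X \<and> g z = g x)" using x assms(2) by metis
    then show "y \<in> (\<lambda>c. f (SOME x. x \<in> X \<and> g x = c)) ` (g ` X)" using x by blast
  qed
  then show ?thesis using assms(1) finite_surj by blast
qed

lemma rcosets_eq_image: "rcosets\<^bsub>G\<^esub> N = (\<lambda>x. N #>\<^bsub>G\<^esub> x) ` carrier G"
  by (auto simp: RCOSETS_def)

lemma (in group) rcos_eq_iff:
  assumes "subgroup N G" "x \<in> carrier G" "y \<in> carrier G"
  shows "N #> x = N #> y \<longleftrightarrow> x \<otimes> inv y \<in> N"
  using repr_independence[of x N y] rcos_self[OF assms(2,1)]
    subgroup.rcos_module[OF assms(1) group_axioms assms(3,2)] assms by auto

lemma fin_normalsD: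
  assumes "N \<in> fin_normals G"
  shows "N \<lhd> G" "subgroup N G" "N \<subseteq> carrier G"
proof -
  show n: "N \<lhd> G" using assms by (simp add: fin_normals_def)
  then show "subgroup N G" by (rule normal_imp_subgroup)
  then show "N \<subseteq> carrier G" by (rule subgroup.subset)
qed

text \<open>The quotient of \<open>G\<close> by the preimage of \<open>M\<close> embeds into the
  finite quotient of \<open>H\<close> by \<open>M\<close>. Completion is functorial because of
  this.\<close>

lemma vimage_fin_normals:
  assumes "group G" "group H" and h: "h \<in> hom G H" and M: "M \<in> fin_normals H"
  shows "{x \<in> carrier G. h x \<in> M} \<in> fin_normals G"
proof -
  interpret G: group G by fact
  interpret H: group H by fact
  interpret group_hom G H h using h by unfold_locales
  let ?N = "{x \<in> carrier G. h x \<in> M}"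
  note M' = fin_normalsD[OF M]
  have sub: "subgroup ?N G"
    using M'(2) by (intro G.subgroupI) (auto simp: subgroup.one_closed subgroup.m_closed subgroup.m_inv_closed
        intro!: exI[of _ "\<one>\<^bsub>G\<^esub>"])
  have "?N \<lhd> G" unfolding G.normal_inv_iff
    using sub H.normal_invE(2)[OF M'(1)] by auto
  moreover have "finite (rcosets\<^bsub>G\<^esub> ?N)" unfolding rcosets_eq_image
  proof (rule finite_image_factor)
    show "finite ((\<lambda>x. M #>\<^bsub>H\<^esub> h x) ` carrier G)"
    proof (rule finite_subset)
      show "(\<lambda>x. M #>\<^bsub>H\<^esub> h x) ` carrier G \<subseteq> rcosets\<^bsub>H\<^esub> M" using H.rcosetsI[OF M'(3)] by auto
      show "finite (rcosets\<^bsub>H\<^esub> M)" using M by (simp add: fin_normals_def)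
    qed
  next
    fix x y assume "x \<in> carrier G" "y \<in> carrier G" "M #>\<^bsub>H\<^esub> h x = M #>\<^bsub>H\<^esub> h y"
    then show "?N #>\<^bsub>G\<^esub> x = ?N #>\<^bsub>G\<^esub> y"
      by (simp add: G.rcos_eq_iff[OF sub] H.rcos_eq_iff[OF M'(2)])
  qed
  ultimately show ?thesis by (simp add: fin_normals_def)
qed

text \<open>Cosets of \<open>N \<inter> M\<close> are separated by the pair of their cosets modulo
  \<open>N\<close> and \<open>M\<close>. The purpose is to let one representative serve two
  homomorphisms at once.\<close>

lemma inter_fin_normals:
  assumes "group G" and N: "N \<in> fin_normals G" and M: "M \<in> fin_normals G"
  shows "N \<inter> M \<in> fin_normals G"
proof -
  interpret G: group G by fact
  note N' = fin_normalsD[OF N] and M' = fin_normalsD[OF M]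
  have sub: "subgroup (N \<inter> M) G" using N'(2) M'(2) by (rule G.subgroups_Inter_pair)
  have "N \<inter> M \<lhd> G" unfolding G.normal_inv_iff
    using sub G.normal_invE(2)[OF N'(1)] G.normal_invE(2)[OF M'(1)] by auto
  moreover have "finite (rcosets\<^bsub>G\<^esub> (N \<inter> M))" unfolding rcosets_eq_image
  proof (rule finite_image_factor)
    show "finite ((\<lambda>x. (N #>\<^bsub>G\<^esub> x, M #>\<^bsub>G\<^esub> x)) ` carrier G)"
    proof (rule finite_subset)
      show "(\<lambda>x. (N #>\<^bsub>G\<^esub> x, M #>\<^bsub>G\<^esub> x)) ` carrier G \<subseteq> (rcosets\<^bsub>G\<^esub> N) \<times> (rcosets\<^bsub>G\<^esub> M)"
        using G.rcosetsI[OF N'(3)] G.rcosetsI[OF M'(3)] by auto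
      show "finite ((rcosets\<^bsub>G\<^esub> N) \<times> (rcosets\<^bsub>G\<^esub> M))" using N M by (simp add: fin_normals_def)
    qed
  qed (use N'(2) M'(2) in \<open>auto simp: G.rcos_eq_iff[OF sub] G.rcos_eq_iff\<close>)
  ultimately show ?thesis by (simp add: fin_normals_def)
qed

section \<open>Elements of the completion as compatible families of cosets\<close>

lemma prof_completionD:
  assumes "f \<in> carrier (prof_completion G)"
  shows "N \<in> fin_normals G \<Longrightarrow> f N \<in> rcosets\<^bsub>G\<^esub> N"
    and "N \<in> fin_normals G \<Longrightarrow> M \<in> fin_normals G \<Longrightarrow> N \<subseteq> M \<Longrightarrow> f N \<subseteq> f M"
    and "f \<in> extensional (fin_normals G)"
  using assms by (auto simp: prof_completion_def PiE_def)

lemma prof_completion_eqI: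
  assumes "f \<in> carrier (prof_completion G)" "g \<in> carrier (prof_completion G)"
    and "\<And>N. N \<in> fin_normals G \<Longrightarrow> f N = g N"
  shows "f = g"
  using prof_completionD(3)[OF assms(1)] prof_completionD(3)[OF assms(2)] assms(3)
  by (rule extensionalityI)

lemma prof_completion_coset:
  assumes "group G" "f \<in> carrier (prof_completion G)" "N \<in> fin_normals G"
  shows "\<exists>x. x \<in> f N" and "x \<in> f N \<Longrightarrow> x \<in> carrier G" and "x \<in> f N \<Longrightarrow> f N = N #>\<^bsub>G\<^esub> x"
proof -
  interpret G: group G by fact
  obtain y where y: "y \<in> carrier G" "f N = N #>\<^bsub>G\<^esub> y"
    using prof_completionD(1)[OF assms(2,3)] by (auto simp: RCOSETS_def)
  note N = fin_normalsD[OF assms(3)]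
  show "\<exists>x. x \<in> f N" using y G.rcos_self N by metis
  show "x \<in> f N \<Longrightarrow> x \<in> carrier G" using y G.r_coset_subset_G[OF N(3)] by blast
  show "x \<in> f N \<Longrightarrow> f N = N #>\<^bsub>G\<^esub> x" using y G.repr_independence N by metis
qed

lemma prof_completion_mult:
  assumes "group G" "f \<in> carrier (prof_completion G)" "g \<in> carrier (prof_completion G)"
    and N: "N \<in> fin_normals G" and "x \<in> f N" "y \<in> g N"
  shows "(f \<otimes>\<^bsub>prof_completion G\<^esub> g) N = N #>\<^bsub>G\<^esub> (x \<otimes>\<^bsub>G\<^esub> y)"
proof -
  have "(f \<otimes>\<^bsub>prof_completion G\<^esub> g) N = (N #>\<^bsub>G\<^esub> x) <#>\<^bsub>G\<^esub> (N #>\<^bsub>G\<^esub> y)"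
    using N prof_completion_coset(3)[OF assms(1,2) N] prof_completion_coset(3)[OF assms(1,3) N] assms(5,6)
    by (simp add: prof_completion_def)
  also have "\<dots> = N #>\<^bsub>G\<^esub> (x \<otimes>\<^bsub>G\<^esub> y)"
    using normal.rcos_sum[OF fin_normalsD(1)[OF N]] prof_completion_coset(2)[OF assms(1,2) N]
      prof_completion_coset(2)[OF assms(1,3) N] assms(5,6) by blast
  finally show ?thesis .
qed

lemma r_coset_mono: "N \<subseteq> M \<Longrightarrow> N #>\<^bsub>G\<^esub> x \<subseteq> M #>\<^bsub>G\<^esub> x"
  by (auto simp: r_coset_def)

text \<open>A common representative for \<open>N \<subseteq> M\<close> yields compatibility, and
  with \<open>M = N\<close> it also yields that each coordinate is a coset.\<close>

lemma prof_completionI: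
  assumes "group G" and ext: "f \<in> extensional (fin_normals G)"
    and mem: "\<And>N M. N \<in> fin_normals G \<Longrightarrow> M \<in> fin_normals G \<Longrightarrow> N \<subseteq> M \<Longrightarrow>
      \<exists>x\<in>carrier G. f N = N #>\<^bsub>G\<^esub> x \<and> f M = M #>\<^bsub>G\<^esub> x"
  shows "f \<in> carrier (prof_completion G)"
proof -
  have "f N \<in> rcosets\<^bsub>G\<^esub> N" if "N \<in> fin_normals G" for N
    using mem[OF that that] by (auto simp: RCOSETS_def)
  moreover have "f N \<subseteq> f M" if "N \<in> fin_normals G" "M \<in> fin_normals G" "N \<subseteq> M" for N M
    using mem[OF that] r_coset_mono[OF that(3)] by metis
  ultimately show ?thesis using ext by (auto simp: prof_completion_def PiE_def)
qed

lemma prof_completion_closed: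
  assumes G: "group G" and f: "f \<in> carrier (prof_completion G)" and g: "g \<in> carrier (prof_completion G)"
  shows "f \<otimes>\<^bsub>prof_completion G\<^esub> g \<in> carrier (prof_completion G)"
proof (rule prof_completionI[OF G])
  interpret G: group G by fact
  show "f \<otimes>\<^bsub>prof_completion G\<^esub> g \<in> extensional (fin_normals G)" by (simp add: prof_completion_def)
  fix N M assume NM: "N \<in> fin_normals G" "M \<in> fin_normals G" "N \<subseteq> M"
  obtain x y where xy: "x \<in> f N" "y \<in> g N"
    using prof_completion_coset(1)[OF G f NM(1)] prof_completion_coset(1)[OF G g NM(1)] by blast
  then have "x \<in> f M" "y \<in> g M" using prof_completionD(2)[OF f NM] prof_completionD(2)[OF g NM] by auto
  then show "\<exists>z\<in>carrier G. (f \<otimes>\<^bsub>prof_completion G\<^esub> g) N = N #>\<^bsub>G\<^esub> z \<and> (f \<otimes>\<^bsub>prof_completion G\<^esub> g) M = M #>\<^bsub>G\<^esub> z"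
    using xy prof_completion_mult[OF G f g] NM prof_completion_coset(2)[OF G f NM(1)]
      prof_completion_coset(2)[OF G g NM(1)] by (intro bexI[of _ "x \<otimes>\<^bsub>G\<^esub> y"]) auto
qed

section \<open>Functoriality of the completion\<close>

text \<open>The coordinate of \<open>f\<close> at the preimage of \<open>M\<close> is a coset that
  \<open>h\<close> carries into a single coset of \<open>M\<close>; \<open>SOME\<close> picks a
  representative, and \<open>prof_map_eq\<close> shows that the choice does not matter.\<close>

definition prof_map :: "('a, 'c) monoid_scheme \<Rightarrow> ('b, 'd) monoid_scheme \<Rightarrow> ('a \<Rightarrow> 'b) \<Rightarrow>
    ('a set \<Rightarrow> 'a set) \<Rightarrow> 'b set \<Rightarrow> 'b set" where
  "prof_map G H h f = (\<lambda>M\<in>fin_normals H. M #>\<^bsub>H\<^esub> h (SOME x. x \<in> f {x \<in> carrier G. h x \<in> M}))"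

text \<open>By compatibility a representative at \<open>N\<close> is also one at the full preimage
  of \<open>M\<close>, which contains \<open>N\<close>. Computing from any such \<open>N\<close> is
  what allows several coordinates to be evaluated with one representative.\<close>

lemma prof_map_eq:
  assumes G: "group G" and H: "group H" and h: "h \<in> hom G H"
    and f: "f \<in> carrier (prof_completion G)" and M: "M \<in> fin_normals H" and N: "N \<in> fin_normals G"
    and sub: "\<And>x. x \<in> N \<Longrightarrow> h x \<in> M" and x: "x \<in> f N"
  shows "prof_map G H h f M = M #>\<^bsub>H\<^esub> h x"
proof -
  interpret G: group G by fact
  interpret H: group H by fact
  interpret group_hom G H h using h by unfold_locales
  let ?V = "{x \<in> carrier G. h x \<in> M}"
  have V: "?V \<in> fin_normals G" by (rule vimage_fin_normals[OF G H h M])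
  define y where "y = (SOME x. x \<in> f ?V)"
  have y: "y \<in> f ?V" unfolding y_def using prof_completion_coset(1)[OF G f V] by (rule someI_ex)
  have "N \<subseteq> ?V" using sub fin_normalsD[OF N] by auto
  then have x': "x \<in> f ?V" using prof_completionD(2)[OF f N V] x by auto
  have c: "x \<in> carrier G" "y \<in> carrier G" using prof_completion_coset(2)[OF G f V] x' y by auto
  have "?V #>\<^bsub>G\<^esub> y = ?V #>\<^bsub>G\<^esub> x" using prof_completion_coset(3)[OF G f V] x' y by auto
  then have "M #>\<^bsub>H\<^esub> h y = M #>\<^bsub>H\<^esub> h x"
    using c G.rcos_eq_iff[OF fin_normalsD(2)[OF V]] H.rcos_eq_iff[OF fin_normalsD(2)[OF M]] by simp
  then show ?thesis using M by (simp add: prof_map_def y_def)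
qed

lemma prof_map_rep:
  assumes G: "group G" and H: "group H" and h: "h \<in> hom G H"
    and f: "f \<in> carrier (prof_completion G)" and M: "M \<in> fin_normals H"
    and x: "x \<in> f {x \<in> carrier G. h x \<in> M}"
  shows "prof_map G H h f M = M #>\<^bsub>H\<^esub> h x" "h x \<in> prof_map G H h f M"
proof -
  note V = vimage_fin_normals[OF G H h M]
  show "prof_map G H h f M = M #>\<^bsub>H\<^esub> h x" by (rule prof_map_eq[OF G H h f M V _ x]) simp
  then show "h x \<in> prof_map G H h f M"
    using prof_completion_coset(2)[OF G f V x] hom_in_carrier[OF h] group.rcos_self[OF H] fin_normalsD(2)[OF M] by metis
qed

lemma prof_map_closed:
  assumes G: "group G" and H: "group H" and h: "h \<in> hom G H" and f: "f \<in> carrier (prof_completion G)"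
  shows "prof_map G H h f \<in> carrier (prof_completion H)"
proof (rule prof_completionI[OF H])
  show "prof_map G H h f \<in> extensional (fin_normals H)" by (simp add: prof_map_def)
  fix N M assume NM: "N \<in> fin_normals H" "M \<in> fin_normals H" "N \<subseteq> M"
  note V = vimage_fin_normals[OF G H h NM(1)]
  obtain x where x: "x \<in> f {x \<in> carrier G. h x \<in> N}" using prof_completion_coset(1)[OF G f V] by blast
  have "prof_map G H h f M = M #>\<^bsub>H\<^esub> h x" by (rule prof_map_eq[OF G H h f NM(2) V _ x]) (use NM in auto)
  moreover have "prof_map G H h f N = N #>\<^bsub>H\<^esub> h x" by (rule prof_map_rep(1)[OF G H h f NM(1) x])
  ultimately show "\<exists>z\<in>carrier H. prof_map G H h f N = N #>\<^bsub>H\<^esub> z \<and> prof_map G H h f M = M #>\<^bsub>H\<^esub> z"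
    using hom_in_carrier[OF h prof_completion_coset(2)[OF G f V x]] by blast
qed

lemma prof_map_hom:
  assumes G: "group G" and H: "group H" and h: "h \<in> hom G H"
  shows "prof_map G H h \<in> hom (prof_completion G) (prof_completion H)"
proof (rule homI)
  fix f g assume f: "f \<in> carrier (prof_completion G)" and g: "g \<in> carrier (prof_completion G)"
  note fg = prof_completion_closed[OF G f g]
  show "prof_map G H h (f \<otimes>\<^bsub>prof_completion G\<^esub> g) =
      prof_map G H h f \<otimes>\<^bsub>prof_completion H\<^esub> prof_map G H h g"
  proof (rule prof_completion_eqI)
    show "prof_map G H h (f \<otimes>\<^bsub>prof_completion G\<^esub> g) \<in> carrier (prof_completion H)"
      by (rule prof_map_closed[OF G H h fg])
    show "prof_map G H h f \<otimes>\<^bsub>prof_completion H\<^esub> prof_map G H h g \<in> carrier (prof_completion H)"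
      by (intro prof_completion_closed prof_map_closed G H h f g)
    fix M assume M: "M \<in> fin_normals H"
    note V = vimage_fin_normals[OF G H h M]
    let ?V = "{x \<in> carrier G. h x \<in> M}"
    obtain x y where xy: "x \<in> f ?V" "y \<in> g ?V"
      using prof_completion_coset(1)[OF G f V] prof_completion_coset(1)[OF G g V] by blast
    have c: "x \<in> carrier G" "y \<in> carrier G"
      using prof_completion_coset(2)[OF G f V xy(1)] prof_completion_coset(2)[OF G g V xy(2)] .
    have "x \<otimes>\<^bsub>G\<^esub> y \<in> (f \<otimes>\<^bsub>prof_completion G\<^esub> g) ?V"
      using prof_completion_mult[OF G f g V xy] group.rcos_self[OF G _ fin_normalsD(2)[OF V]] c
        monoid.m_closed[OF group.is_monoid[OF G]] by metis
    then have "prof_map G H h (f \<otimes>\<^bsub>prof_completion G\<^esub> g) M = M #>\<^bsub>H\<^esub> (h x \<otimes>\<^bsub>H\<^esub> h y)"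
      using prof_map_rep(1)[OF G H h fg M] hom_mult[OF h c] by simp
    also have "\<dots> = (prof_map G H h f \<otimes>\<^bsub>prof_completion H\<^esub> prof_map G H h g) M"
      using prof_completion_mult[OF H prof_map_closed[OF G H h f] prof_map_closed[OF G H h g] M
        prof_map_rep(2)[OF G H h f M xy(1)] prof_map_rep(2)[OF G H h g M xy(2)]] by simp
    finally show "prof_map G H h (f \<otimes>\<^bsub>prof_completion G\<^esub> g) M =
      (prof_map G H h f \<otimes>\<^bsub>prof_completion H\<^esub> prof_map G H h g) M" .
  qed
qed (rule prof_map_closed[OF G H h])

text \<open>A representative at the iterated preimage of \<open>M\<close> can be pushed through
  \<open>h\<close> and then \<open>k\<close>. Taking the composite as a separate \<open>l\<close>
  lets a projection after an inclusion be given directly as an identity or a constant map.\<close>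

lemma prof_map_comp:
  assumes G: "group G" and H: "group H" and K: "group K" and h: "h \<in> hom G H" and k: "k \<in> hom H K"
    and l: "l \<in> hom G K" "\<And>x. x \<in> carrier G \<Longrightarrow> l x = k (h x)" and f: "f \<in> carrier (prof_completion G)"
  shows "prof_map H K k (prof_map G H h f) = prof_map G K l f"
proof (rule prof_completion_eqI)
  note hf = prof_map_closed[OF G H h f]
  show "prof_map H K k (prof_map G H h f) \<in> carrier (prof_completion K)" by (rule prof_map_closed[OF H K k hf])
  show "prof_map G K l f \<in> carrier (prof_completion K)" by (rule prof_map_closed[OF G K l(1) f])
  fix M assume M: "M \<in> fin_normals K"
  note W = vimage_fin_normals[OF H K k M]
  let ?W = "{x \<in> carrier H. k x \<in> M}"
  note V = vimage_fin_normals[OF G H h W]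
  obtain x where x: "x \<in> f {x \<in> carrier G. h x \<in> ?W}" using prof_completion_coset(1)[OF G f V] by blast
  have "prof_map H K k (prof_map G H h f) M = M #>\<^bsub>K\<^esub> k (h x)"
    by (rule prof_map_rep(1)[OF H K k hf M prof_map_rep(2)[OF G H h f W x]])
  moreover have "prof_map G K l f M = M #>\<^bsub>K\<^esub> l x"
    by (rule prof_map_eq[OF G K l(1) f M V _ x]) (simp add: l(2))
  ultimately show "prof_map H K k (prof_map G H h f) M = prof_map G K l f M"
    using l(2) prof_completion_coset(2)[OF G f V x] by simp
qed

lemma prof_map_id:
  assumes G: "group G" and l: "\<And>x. x \<in> carrier G \<Longrightarrow> l x = x" "l \<in> hom G G"
    and f: "f \<in> carrier (prof_completion G)"
  shows "prof_map G G l f = f"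
proof (rule prof_completion_eqI[OF prof_map_closed[OF G G l(2) f] f])
  fix N assume N: "N \<in> fin_normals G"
  obtain x where x: "x \<in> f N" using prof_completion_coset(1)[OF G f N] by blast
  have "prof_map G G l f N = N #>\<^bsub>G\<^esub> l x"
    by (rule prof_map_eq[OF G G l(2) f N N _ x]) (use l fin_normalsD(3)[OF N] in auto)
  then show "prof_map G G l f N = f N"
    using l(1)[of x] prof_completion_coset(2,3)[OF G f N x] by simp
qed

text \<open>On the intersection of the two preimages a single representative \<open>x\<close> serves
  \<open>h\<close> and \<open>k\<close>, and the coordinates multiply to the coset of
  \<open>h x \<otimes> k x = l x\<close>. Applied to the two coordinate parts of a product, this
  reassembles an element of its completion.\<close>

lemma prof_map_mult:
  assumes G: "group G" and H: "group H" and h: "h \<in> hom G H" and k: "k \<in> hom G H"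
    and l: "l \<in> hom G H" "\<And>x. x \<in> carrier G \<Longrightarrow> l x = h x \<otimes>\<^bsub>H\<^esub> k x"
    and f: "f \<in> carrier (prof_completion G)"
  shows "prof_map G H h f \<otimes>\<^bsub>prof_completion H\<^esub> prof_map G H k f = prof_map G H l f"
proof (rule prof_completion_eqI)
  interpret H: group H by fact
  note hf = prof_map_closed[OF G H h f] and kf = prof_map_closed[OF G H k f]
  show "prof_map G H h f \<otimes>\<^bsub>prof_completion H\<^esub> prof_map G H k f \<in> carrier (prof_completion H)"
    by (rule prof_completion_closed[OF H hf kf])
  show "prof_map G H l f \<in> carrier (prof_completion H)" by (rule prof_map_closed[OF G H l(1) f])
  fix M assume M: "M \<in> fin_normals H"
  let ?N = "{x \<in> carrier G. h x \<in> M} \<inter> {x \<in> carrier G. k x \<in> M}"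
  have N: "?N \<in> fin_normals G"
    by (rule inter_fin_normals[OF G vimage_fin_normals[OF G H h M] vimage_fin_normals[OF G H k M]])
  obtain x where x: "x \<in> f ?N" using prof_completion_coset(1)[OF G f N] by blast
  have xc: "x \<in> carrier G" by (rule prof_completion_coset(2)[OF G f N x])
  have eh: "prof_map G H h f M = M #>\<^bsub>H\<^esub> h x" by (rule prof_map_eq[OF G H h f M N _ x]) simp
  have ek: "prof_map G H k f M = M #>\<^bsub>H\<^esub> k x" by (rule prof_map_eq[OF G H k f M N _ x]) simp
  have "prof_map G H l f M = M #>\<^bsub>H\<^esub> l x"
    by (rule prof_map_eq[OF G H l(1) f M N _ x]) (simp add: l(2) subgroup.m_closed[OF fin_normalsD(2)[OF M]])
  moreover have "(prof_map G H h f \<otimes>\<^bsub>prof_completion H\<^esub> prof_map G H k f) M = M #>\<^bsub>H\<^esub> (h x \<otimes>\<^bsub>H\<^esub> k x)"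
    by (rule prof_completion_mult[OF H hf kf M])
      (use eh ek xc hom_in_carrier[OF h] hom_in_carrier[OF k] H.rcos_self fin_normalsD(2)[OF M] in auto)
  ultimately show "(prof_map G H h f \<otimes>\<^bsub>prof_completion H\<^esub> prof_map G H k f) M = prof_map G H l f M"
    using l(2)[OF xc] by simp
qed

text \<open>Every coordinate of the image contains the identity. The conclusion is phrased for a
  factor because this is how cross terms disappear when the components of a product are
  computed.\<close>

lemma prof_map_one:
  assumes G: "group G" and H: "group H" and f: "f \<in> carrier (prof_completion G)"
    and l: "l \<in> hom G H" "\<And>x. x \<in> carrier G \<Longrightarrow> l x = \<one>\<^bsub>H\<^esub>"
    and g: "g \<in> carrier (prof_completion H)"
  shows "prof_map G H l f \<otimes>\<^bsub>prof_completion H\<^esub> g = g" "g \<otimes>\<^bsub>prof_completion H\<^esub> prof_map G H l f = g"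
proof -
  interpret H: group H by fact
  note lf = prof_map_closed[OF G H l(1) f]
  have "(prof_map G H l f \<otimes>\<^bsub>prof_completion H\<^esub> g) M = g M \<and> (g \<otimes>\<^bsub>prof_completion H\<^esub> prof_map G H l f) M = g M"
    if M: "M \<in> fin_normals H" for M
  proof -
    note V = vimage_fin_normals[OF G H l(1) M]
    obtain x where x: "x \<in> f {x \<in> carrier G. l x \<in> M}" using prof_completion_coset(1)[OF G f V] by blast
    then have o: "\<one>\<^bsub>H\<^esub> \<in> prof_map G H l f M"
      using prof_map_rep(2)[OF G H l(1) f M x] l(2) prof_completion_coset(2)[OF G f V x] by simp
    obtain y where y: "y \<in> g M" using prof_completion_coset(1)[OF H g M] by blast
    show ?thesis
      using prof_completion_mult[OF H lf g M o y] prof_completion_mult[OF H g lf M y o]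
        prof_completion_coset(2,3)[OF H g M y] by simp
  qed
  then show "prof_map G H l f \<otimes>\<^bsub>prof_completion H\<^esub> g = g" "g \<otimes>\<^bsub>prof_completion H\<^esub> prof_map G H l f = g"
    by (auto intro!: prof_completion_eqI prof_completion_closed H g lf)
qed

section \<open>The topology of the completion\<close>

lemma topspace_prof_topology [simp]: "topspace (prof_topology G) = carrier (prof_completion G)"
  by (auto simp: prof_topology_def prof_completion_def)

lemma continuous_map_prof_topology_iff:
  "continuous_map X (prof_topology G) f \<longleftrightarrow> f \<in> topspace X \<rightarrow> carrier (prof_completion G) \<and>
     (\<forall>N\<in>fin_normals G. continuous_map X (discrete_topology (rcosets\<^bsub>G\<^esub> N)) (\<lambda>x. f x N))"
  unfolding prof_topology_def continuous_map_in_subtopology continuous_map_componentwise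
  by (auto simp: prof_completion_def PiE_def)

lemma continuous_map_prof_coordinate:
  assumes "N \<in> fin_normals G"
  shows "continuous_map (prof_topology G) (discrete_topology (rcosets\<^bsub>G\<^esub> N)) (\<lambda>f. f N)"
  using assms continuous_map_prof_topology_iff[of "prof_topology G" G id] by simp

text \<open>The preimage of \<open>W\<close> under \<open>g\<close> is the preimage under
  \<open>f\<close> of some set of points, and such a set is open in a discrete space. It applies
  because a coordinate of \<open>prof_map\<close> depends on one coordinate of its argument, and a
  coordinate of a product on the two matching coordinates.\<close>

lemma continuous_map_discrete_factor:
  assumes "continuous_map X (discrete_topology U) f" "g \<in> topspace X \<rightarrow> V"
    and "\<And>x y. x \<in> topspace X \<Longrightarrow> y \<in> topspace X \<Longrightarrow> f x = f y \<Longrightarrow> g x = g y"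
  shows "continuous_map X (discrete_topology V) g"
  unfolding continuous_map_def
proof (intro conjI allI impI)
  show "g \<in> topspace X \<rightarrow> topspace (discrete_topology V)" using assms(2) by simp
  fix W
  have fU: "f \<in> topspace X \<rightarrow> U" using assms(1) by (simp add: continuous_map_def)
  let ?V = "f ` {x \<in> topspace X. g x \<in> W}"
  have "g x \<in> W \<longleftrightarrow> f x \<in> ?V" if x: "x \<in> topspace X" for x
  proof
    assume "f x \<in> ?V"
    then obtain y where y: "f x = f y" "y \<in> topspace X" "g y \<in> W" by blast
    then show "g x \<in> W" using assms(3)[OF x y(2,1)] by simp
  qed (use x in blast)
  then have "{x \<in> topspace X. g x \<in> W} = {x \<in> topspace X. f x \<in> ?V}" by blast
  also have "openin X \<dots>"
    by (rule openin_continuous_map_preimage[OF assms(1)]) (use fU in auto)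
  finally show "openin X {x \<in> topspace X. g x \<in> W}" .
qed

lemma prof_map_continuous:
  assumes G: "group G" and H: "group H" and h: "h \<in> hom G H"
  shows "continuous_map (prof_topology G) (prof_topology H) (prof_map G H h)"
  unfolding continuous_map_prof_topology_iff
proof (intro conjI ballI)
  show "prof_map G H h \<in> topspace (prof_topology G) \<rightarrow> carrier (prof_completion H)"
    using prof_map_closed[OF G H h] by simp
  fix M assume M: "M \<in> fin_normals H"
  show "continuous_map (prof_topology G) (discrete_topology (rcosets\<^bsub>H\<^esub> M)) (\<lambda>f. prof_map G H h f M)"
    by (rule continuous_map_discrete_factor[OF continuous_map_prof_coordinate[OF vimage_fin_normals[OF G H h M]]])
      (use M prof_completionD(1)[OF prof_map_closed[OF G H h] M] in \<open>auto simp: prof_map_def[of G H h]\<close>)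
qed

lemma prof_mult_continuous:
  assumes G: "group G" and a: "continuous_map X (prof_topology G) a" and b: "continuous_map X (prof_topology G) b"
  shows "continuous_map X (prof_topology G) (\<lambda>x. a x \<otimes>\<^bsub>prof_completion G\<^esub> b x)"
  unfolding continuous_map_prof_topology_iff
proof (intro conjI ballI)
  have ac: "a x \<in> carrier (prof_completion G)" "b x \<in> carrier (prof_completion G)" if "x \<in> topspace X" for x
    using a b that by (auto simp: continuous_map_prof_topology_iff)
  then have cl: "a x \<otimes>\<^bsub>prof_completion G\<^esub> b x \<in> carrier (prof_completion G)" if "x \<in> topspace X" for x
    using prof_completion_closed[OF G] that by blast
  then show "(\<lambda>x. a x \<otimes>\<^bsub>prof_completion G\<^esub> b x) \<in> topspace X \<rightarrow> carrier (prof_completion G)" by blast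
  fix N assume N: "N \<in> fin_normals G"
  have "continuous_map X (discrete_topology ((rcosets\<^bsub>G\<^esub> N) \<times> (rcosets\<^bsub>G\<^esub> N))) (\<lambda>x. (a x N, b x N))"
    unfolding prod_topology_discrete_topology continuous_map_pairwise
    using a b N by (auto simp: continuous_map_prof_topology_iff o_def)
  then show "continuous_map X (discrete_topology (rcosets\<^bsub>G\<^esub> N)) (\<lambda>x. (a x \<otimes>\<^bsub>prof_completion G\<^esub> b x) N)"
    by (rule continuous_map_discrete_factor)
      (use N cl prof_completionD(1) in \<open>auto simp: prof_completion_def\<close>)
qed

section \<open>Topological isomorphisms of completions\<close>

lemma prof_isoI:
  assumes "\<phi> \<in> hom (prof_completion G) (prof_completion H)"
    and "homeomorphic_maps (prof_topology G) (prof_topology H) \<phi> \<psi>"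
  shows "prof_iso G H"
proof -
  have hm: "homeomorphic_map (prof_topology G) (prof_topology H) \<phi>"
    using assms(2) homeomorphic_map_maps by blast
  then have "bij_betw \<phi> (carrier (prof_completion G)) (carrier (prof_completion H))"
    using homeomorphic_eq_everything_map[of "prof_topology G" "prof_topology H" \<phi>]
    by (simp add: bij_betw_def)
  then show ?thesis using hm assms(1) by (auto simp: prof_iso_def iso_def)
qed

lemma prof_isoE:
  assumes "prof_iso G H"
  obtains \<phi> \<psi> where "\<phi> \<in> hom (prof_completion G) (prof_completion H)"
    and "homeomorphic_maps (prof_topology G) (prof_topology H) \<phi> \<psi>"
  using assms homeomorphic_map_maps that unfolding prof_iso_def iso_def by blast

lemma prof_iso_trans:
  assumes "prof_iso G H" "prof_iso H K"
  shows "prof_iso G K"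
  using assms unfolding prof_iso_def
  using homeomorphic_map_compose iso_set_trans by blast

text \<open>By functoriality, inverse homomorphisms induce inverse continuous homomorphisms.\<close>

lemma iso_imp_prof_iso:
  assumes G: "group G" and H: "group H" and "G \<cong> H"
  shows "prof_iso G H"
proof -
  obtain h where h: "h \<in> iso G H" using assms(3) by (auto simp: is_iso_def)
  define k where "k = inv_into (carrier G) h"
  have bij: "bij_betw h (carrier G) (carrier H)" and hh: "h \<in> hom G H" using h by (auto simp: iso_def)
  have kh: "k \<in> hom H G" using group.iso_set_sym[OF G h] by (simp add: k_def iso_def)
  have kh1: "k (h x) = x" if "x \<in> carrier G" for x using bij that by (simp add: k_def bij_betw_inv_into_left)
  have hk1: "h (k x) = x" if "x \<in> carrier H" for x using bij that by (simp add: k_def bij_betw_inv_into_right)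
  have id: "(\<lambda>x. x) \<in> hom G G" "(\<lambda>x. x) \<in> hom H H" by (auto simp: hom_def)
  have "prof_map H G k (prof_map G H h f) = f" if "f \<in> carrier (prof_completion G)" for f
    using prof_map_comp[OF G H G hh kh id(1) _ that] prof_map_id[OF G _ id(1) that] kh1 by simp
  moreover have "prof_map G H h (prof_map H G k f) = f" if "f \<in> carrier (prof_completion H)" for f
    using prof_map_comp[OF H G H kh hh id(2) _ that] prof_map_id[OF H _ id(2) that] hk1 by simp
  ultimately have "homeomorphic_maps (prof_topology G) (prof_topology H) (prof_map G H h) (prof_map H G k)"
    using prof_map_continuous[OF G H hh] prof_map_continuous[OF H G kh] by (simp add: homeomorphic_maps_def)
  then show ?thesis by (rule prof_isoI[OF prof_map_hom[OF G H hh]])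
qed

text \<open>The product of \<open>\<phi>\<close> with the identity of the completion of \<open>D\<close>, read through the
identification of the completion of a product with the product of the completions.\<close>

definition prof_prod_map :: "('a, 'c) monoid_scheme \<Rightarrow> ('b, 'd) monoid_scheme \<Rightarrow> ('e, 'f) monoid_scheme \<Rightarrow>
    (('a set \<Rightarrow> 'a set) \<Rightarrow> ('b set \<Rightarrow> 'b set)) \<Rightarrow>
    (('a \<times> 'e) set \<Rightarrow> ('a \<times> 'e) set) \<Rightarrow> ('b \<times> 'e) set \<Rightarrow> ('b \<times> 'e) set" where
  "prof_prod_map G H D \<phi> f =
     prof_map H (H \<times>\<times> D) (\<lambda>x. (x, \<one>\<^bsub>D\<^esub>)) (\<phi> (prof_map (G \<times>\<times> D) G fst f))
     \<otimes>\<^bsub>prof_completion (H \<times>\<times> D)\<^esub>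
     prof_map D (H \<times>\<times> D) (\<lambda>d. (\<one>\<^bsub>H\<^esub>, d)) (prof_map (G \<times>\<times> D) D snd f)"

section \<open>Components of the completion of a product\<close>

context
  fixes G :: "('a, 'c) monoid_scheme" and D :: "('b, 'd) monoid_scheme"
  assumes G: "group G" and D: "group D"
begin

interpretation G: group G by fact
interpretation D: group D by fact

lemma prod_homs:
  "fst \<in> hom (G \<times>\<times> D) G" "snd \<in> hom (G \<times>\<times> D) D"
  "(\<lambda>x. (x, \<one>\<^bsub>D\<^esub>)) \<in> hom G (G \<times>\<times> D)" "(\<lambda>d. (\<one>\<^bsub>G\<^esub>, d)) \<in> hom D (G \<times>\<times> D)"
  by (auto simp: hom_def)

text \<open>A projection after its own inclusion is the identity, and after the other inclusion it
  is trivial. Together with \<open>prof_prod_decomp\<close> this identifies the completion of the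
  product with the product of the completions.\<close>

lemma prof_prod_components:
  assumes a: "a \<in> carrier (prof_completion G)" and b: "b \<in> carrier (prof_completion D)"
  defines "c \<equiv> prof_map G (G \<times>\<times> D) (\<lambda>x. (x, \<one>\<^bsub>D\<^esub>)) a \<otimes>\<^bsub>prof_completion (G \<times>\<times> D)\<^esub>
     prof_map D (G \<times>\<times> D) (\<lambda>d. (\<one>\<^bsub>G\<^esub>, d)) b"
  shows "c \<in> carrier (prof_completion (G \<times>\<times> D))"
    "prof_map (G \<times>\<times> D) G fst c = a" "prof_map (G \<times>\<times> D) D snd c = b"
proof -
  note GD = DirProd_group[OF G D]
  note pa = prof_map_closed[OF G GD prod_homs(3) a] and pb = prof_map_closed[OF D GD prod_homs(4) b]
  show "c \<in> carrier (prof_completion (G \<times>\<times> D))"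
    unfolding c_def by (rule prof_completion_closed[OF GD pa pb])
  have homs: "(\<lambda>x. x) \<in> hom G G" "(\<lambda>x. x) \<in> hom D D" "(\<lambda>_. \<one>\<^bsub>D\<^esub>) \<in> hom G D" "(\<lambda>_. \<one>\<^bsub>G\<^esub>) \<in> hom D G"
    by (auto simp: hom_def)
  have "prof_map (G \<times>\<times> D) G fst c = prof_map G G (\<lambda>x. x) a \<otimes>\<^bsub>prof_completion G\<^esub> prof_map D G (\<lambda>_. \<one>\<^bsub>G\<^esub>) b"
    unfolding c_def hom_mult[OF prof_map_hom[OF GD G prod_homs(1)] pa pb]
    using prof_map_comp[OF G GD G prod_homs(3,1) homs(1) _ a] prof_map_comp[OF D GD G prod_homs(4,1) homs(4) _ b]
    by simp
  then show "prof_map (G \<times>\<times> D) G fst c = a"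
    using prof_map_id[OF G _ homs(1) a] prof_map_one(2)[OF D G b homs(4) _ a] by simp
  have "prof_map (G \<times>\<times> D) D snd c = prof_map G D (\<lambda>_. \<one>\<^bsub>D\<^esub>) a \<otimes>\<^bsub>prof_completion D\<^esub> prof_map D D (\<lambda>x. x) b"
    unfolding c_def hom_mult[OF prof_map_hom[OF GD D prod_homs(2)] pa pb]
    using prof_map_comp[OF G GD D prod_homs(3,2) homs(3) _ a] prof_map_comp[OF D GD D prod_homs(4,2) homs(2) _ b]
    by simp
  then show "prof_map (G \<times>\<times> D) D snd c = b"
    using prof_map_id[OF D _ homs(2) b] prof_map_one(1)[OF G D a homs(3) _ b] by simp
qed

text \<open>The pointwise identity \<open>(x, d) = (x, \<one>)(\<one>, d)\<close> passes to
  completions by \<open>prof_map_mult\<close>. In particular the two components determine the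
  element.\<close>

lemma prof_prod_decomp:
  assumes f: "f \<in> carrier (prof_completion (G \<times>\<times> D))"
  shows "prof_map G (G \<times>\<times> D) (\<lambda>x. (x, \<one>\<^bsub>D\<^esub>)) (prof_map (G \<times>\<times> D) G fst f)
     \<otimes>\<^bsub>prof_completion (G \<times>\<times> D)\<^esub>
     prof_map D (G \<times>\<times> D) (\<lambda>d. (\<one>\<^bsub>G\<^esub>, d)) (prof_map (G \<times>\<times> D) D snd f) = f"
proof -
  note GD = DirProd_group[OF G D]
  have homs: "(\<lambda>x. (fst x, \<one>\<^bsub>D\<^esub>)) \<in> hom (G \<times>\<times> D) (G \<times>\<times> D)" "(\<lambda>x. (\<one>\<^bsub>G\<^esub>, snd x)) \<in> hom (G \<times>\<times> D) (G \<times>\<times> D)"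
    "(\<lambda>x. x) \<in> hom (G \<times>\<times> D) (G \<times>\<times> D)"
    by (auto simp: hom_def)
  have "prof_map G (G \<times>\<times> D) (\<lambda>x. (x, \<one>\<^bsub>D\<^esub>)) (prof_map (G \<times>\<times> D) G fst f) = prof_map (G \<times>\<times> D) (G \<times>\<times> D) (\<lambda>x. (fst x, \<one>\<^bsub>D\<^esub>)) f"
    by (rule prof_map_comp[OF GD G GD prod_homs(1,3) homs(1) _ f]) simp
  moreover have "prof_map D (G \<times>\<times> D) (\<lambda>d. (\<one>\<^bsub>G\<^esub>, d)) (prof_map (G \<times>\<times> D) D snd f) = prof_map (G \<times>\<times> D) (G \<times>\<times> D) (\<lambda>x. (\<one>\<^bsub>G\<^esub>, snd x)) f"
    by (rule prof_map_comp[OF GD D GD prod_homs(2,4) homs(2) _ f]) simp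
  moreover have "prof_map (G \<times>\<times> D) (G \<times>\<times> D) (\<lambda>x. (fst x, \<one>\<^bsub>D\<^esub>)) f \<otimes>\<^bsub>prof_completion (G \<times>\<times> D)\<^esub>
      prof_map (G \<times>\<times> D) (G \<times>\<times> D) (\<lambda>x. (\<one>\<^bsub>G\<^esub>, snd x)) f = prof_map (G \<times>\<times> D) (G \<times>\<times> D) (\<lambda>x. x) f"
    by (rule prof_map_mult[OF GD GD homs _ f]) auto
  moreover have "prof_map (G \<times>\<times> D) (G \<times>\<times> D) (\<lambda>x. x) f = f"
    by (rule prof_map_id[OF GD _ homs(3) f]) simp
  ultimately show ?thesis by simp
qed

end

lemma prof_prod_map_components:
  assumes G: "group G" and H: "group H" and D: "group D"
    and \<phi>: "\<phi> \<in> carrier (prof_completion G) \<rightarrow> carrier (prof_completion H)"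
    and f: "f \<in> carrier (prof_completion (G \<times>\<times> D))"
  shows "prof_prod_map G H D \<phi> f \<in> carrier (prof_completion (H \<times>\<times> D))"
    "prof_map (H \<times>\<times> D) H fst (prof_prod_map G H D \<phi> f) = \<phi> (prof_map (G \<times>\<times> D) G fst f)"
    "prof_map (H \<times>\<times> D) D snd (prof_prod_map G H D \<phi> f) = prof_map (G \<times>\<times> D) D snd f"
proof -
  note GD = DirProd_group[OF G D]
  have "\<phi> (prof_map (G \<times>\<times> D) G fst f) \<in> carrier (prof_completion H)"
    using \<phi> prof_map_closed[OF GD G prod_homs(1)[OF G D] f] by blast
  note this prof_map_closed[OF GD D prod_homs(2)[OF G D] f]
  from prof_prod_components[OF H D this]
  show "prof_prod_map G H D \<phi> f \<in> carrier (prof_completion (H \<times>\<times> D))"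
    "prof_map (H \<times>\<times> D) H fst (prof_prod_map G H D \<phi> f) = \<phi> (prof_map (G \<times>\<times> D) G fst f)"
    "prof_map (H \<times>\<times> D) D snd (prof_prod_map G H D \<phi> f) = prof_map (G \<times>\<times> D) D snd f"
    by (simp_all add: prof_prod_map_def)
qed

lemma prof_prod_map_inverse:
  assumes G: "group G" and H: "group H" and D: "group D"
    and \<phi>: "\<phi> \<in> carrier (prof_completion G) \<rightarrow> carrier (prof_completion H)"
    and inv: "\<And>f. f \<in> carrier (prof_completion G) \<Longrightarrow> \<psi> (\<phi> f) = f"
    and f: "f \<in> carrier (prof_completion (G \<times>\<times> D))"
  shows "prof_prod_map H G D \<psi> (prof_prod_map G H D \<phi> f) = f"
  using prof_prod_decomp[OF G D f] prof_prod_map_components[OF G H D \<phi> f]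
    inv[OF prof_map_closed[OF DirProd_group[OF G D] G prod_homs(1)[OF G D] f]]
  by (simp add: prof_prod_map_def[of H G])

lemma prof_prod_map_continuous:
  assumes G: "group G" and H: "group H" and D: "group D"
    and \<phi>: "continuous_map (prof_topology G) (prof_topology H) \<phi>"
  shows "continuous_map (prof_topology (G \<times>\<times> D)) (prof_topology (H \<times>\<times> D)) (prof_prod_map G H D \<phi>)"
proof -
  note GD = DirProd_group[OF G D] and HD = DirProd_group[OF H D]
  have 1: "continuous_map (prof_topology (G \<times>\<times> D)) (prof_topology (H \<times>\<times> D))
      (prof_map H (H \<times>\<times> D) (\<lambda>x. (x, \<one>\<^bsub>D\<^esub>)) \<circ> (\<phi> \<circ> prof_map (G \<times>\<times> D) G fst))"
    by (intro continuous_map_compose[OF _ prof_map_continuous[OF H HD prod_homs(3)[OF H D]]]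
        continuous_map_compose[OF _ \<phi>] prof_map_continuous[OF GD G prod_homs(1)[OF G D]])
  have 2: "continuous_map (prof_topology (G \<times>\<times> D)) (prof_topology (H \<times>\<times> D))
      (prof_map D (H \<times>\<times> D) (\<lambda>d. (\<one>\<^bsub>H\<^esub>, d)) \<circ> prof_map (G \<times>\<times> D) D snd)"
    by (intro continuous_map_compose[OF _ prof_map_continuous[OF D HD prod_homs(4)[OF H D]]]
        prof_map_continuous[OF GD D prod_homs(2)[OF G D]])
  show ?thesis using prof_mult_continuous[OF HD 1 2] by (simp add: prof_prod_map_def[abs_def] o_def)
qed

lemma prof_iso_DirProd:
  assumes G: "group G" and H: "group H" and D: "group D" and iso: "prof_iso G H"
  shows "prof_iso (G \<times>\<times> D) (H \<times>\<times> D)"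
proof -
  obtain \<phi> \<psi> where \<phi>: "\<phi> \<in> hom (prof_completion G) (prof_completion H)"
    and hm: "homeomorphic_maps (prof_topology G) (prof_topology H) \<phi> \<psi>" using prof_isoE[OF iso] .
  note GD = DirProd_group[OF G D] and HD = DirProd_group[OF H D]
  have c\<phi>: "continuous_map (prof_topology G) (prof_topology H) \<phi>" and c\<psi>: "continuous_map (prof_topology H) (prof_topology G) \<psi>"
    and inv: "\<And>f. f \<in> carrier (prof_completion G) \<Longrightarrow> \<psi> (\<phi> f) = f"
      "\<And>f. f \<in> carrier (prof_completion H) \<Longrightarrow> \<phi> (\<psi> f) = f"
    using hm by (auto simp: homeomorphic_maps_def)
  have \<phi>c: "\<phi> \<in> carrier (prof_completion G) \<rightarrow> carrier (prof_completion H)"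
    and \<psi>c: "\<psi> \<in> carrier (prof_completion H) \<rightarrow> carrier (prof_completion G)"
    using c\<phi> c\<psi> by (simp_all add: continuous_map_def)
  let ?\<Phi> = "prof_prod_map G H D \<phi>"
  note comp = prof_prod_map_components[OF G H D \<phi>c]
  have "?\<Phi> \<in> hom (prof_completion (G \<times>\<times> D)) (prof_completion (H \<times>\<times> D))"
  proof (rule homI)
    fix f g assume f: "f \<in> carrier (prof_completion (G \<times>\<times> D))" and g: "g \<in> carrier (prof_completion (G \<times>\<times> D))"
    note fg = prof_completion_closed[OF GD f g]
    note mult = hom_mult[OF prof_map_hom]
    note P = prof_completion_closed[OF HD comp(1)[OF f] comp(1)[OF g]]
    have e1: "prof_map (H \<times>\<times> D) H fst (?\<Phi> (f \<otimes>\<^bsub>prof_completion (G \<times>\<times> D)\<^esub> g)) =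
       prof_map (H \<times>\<times> D) H fst (?\<Phi> f \<otimes>\<^bsub>prof_completion (H \<times>\<times> D)\<^esub> ?\<Phi> g)"
      using comp(2)[OF f] comp(2)[OF g] comp(2)[OF fg] mult[OF GD G prod_homs(1)[OF G D] f g]
        mult[OF HD H prod_homs(1)[OF H D] comp(1)[OF f] comp(1)[OF g]]
        hom_mult[OF \<phi> prof_map_closed[OF GD G prod_homs(1)[OF G D] f] prof_map_closed[OF GD G prod_homs(1)[OF G D] g]]
      by simp
    have e2: "prof_map (H \<times>\<times> D) D snd (?\<Phi> (f \<otimes>\<^bsub>prof_completion (G \<times>\<times> D)\<^esub> g)) =
       prof_map (H \<times>\<times> D) D snd (?\<Phi> f \<otimes>\<^bsub>prof_completion (H \<times>\<times> D)\<^esub> ?\<Phi> g)"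
      using comp(3)[OF f] comp(3)[OF g] comp(3)[OF fg] mult[OF GD D prod_homs(2)[OF G D] f g]
        mult[OF HD D prod_homs(2)[OF H D] comp(1)[OF f] comp(1)[OF g]]
      by simp
    \<comment> \<open>Both sides have equal components by \<open>e1\<close> and \<open>e2\<close>,
      and each side is rebuilt from its components by the same expression.\<close>
    show "?\<Phi> (f \<otimes>\<^bsub>prof_completion (G \<times>\<times> D)\<^esub> g) = ?\<Phi> f \<otimes>\<^bsub>prof_completion (H \<times>\<times> D)\<^esub> ?\<Phi> g"
      using prof_prod_decomp[OF H D comp(1)[OF fg], unfolded e1 e2] prof_prod_decomp[OF H D P]
      by (rule HOL.trans[OF HOL.sym])
  qed (rule comp(1))
  moreover have "homeomorphic_maps (prof_topology (G \<times>\<times> D)) (prof_topology (H \<times>\<times> D)) ?\<Phi> (prof_prod_map H G D \<psi>)"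
    unfolding homeomorphic_maps_def topspace_prof_topology
    using prof_prod_map_continuous[OF G H D c\<phi>] prof_prod_map_continuous[OF H G D c\<psi>]
      prof_prod_map_inverse[OF G H D \<phi>c inv(1)] prof_prod_map_inverse[OF H G D \<psi>c inv(2)]
    by blast
  ultimately show ?thesis by (rule prof_isoI)
qed

section \<open>Coxeter groups\<close>

lemma cox_rel_lists: "(u, w) \<in> cox_rel V E m \<Longrightarrow> u \<in> lists V \<and> w \<in> lists V"
proof (induction rule: cox_rel.induct)
  case (braid xs ys v w)
  have "concat (replicate n [v, w]) \<in> lists V" for n using braid by (induction n) auto
  then show ?case using braid by auto
qed auto

lemma equiv_cox_rel: "equiv (lists V) (cox_rel V E m)"
proof (rule equivI)
  show "refl_on (lists V) (cox_rel V E m)" by (auto simp: refl_on_def intro: cox_rel.refl)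
  show "sym (cox_rel V E m)" by (rule symI) (rule cox_rel.sym)
  show "trans (cox_rel V E m)" by (rule transI) (rule cox_rel.trans)
  show "cox_rel V E m \<subseteq> lists V \<times> lists V"
    using cox_rel_lists[of _ _ V E m] by (metis SigmaI subrelI)
qed

lemma cox_rel_append:
  assumes "(u, w) \<in> cox_rel V E m" "xs \<in> lists V" "ys \<in> lists V"
  shows "(xs @ u @ ys, xs @ w @ ys) \<in> cox_rel V E m"
  using assms
proof (induction rule: cox_rel.induct)
  case (refl w)
  then show ?case using cox_rel.refl[of "xs @ w @ ys" V E m] by simp
next
  case (sym u w)
  then show ?case by (blast intro: cox_rel.sym)
next
  case (trans u w z)
  then show ?case by (blast intro: cox_rel.trans)
next
  case (square us ws v)
  then show ?case using cox_rel.square[of "xs @ us" V "ws @ ys" v E m] by auto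
next
  case (braid us ws v w)
  then show ?case using cox_rel.braid[of "xs @ us" V "ws @ ys" v w E m] by auto
qed

abbreviation cox_class :: "nat set \<Rightarrow> nat set set \<Rightarrow> (nat set \<Rightarrow> nat) \<Rightarrow> nat list \<Rightarrow> nat list set" where
  "cox_class V E m w \<equiv> cox_rel V E m `` {w}"

lemma cox_class_eq_iff:
  "u \<in> lists V \<Longrightarrow> w \<in> lists V \<Longrightarrow> cox_class V E m u = cox_class V E m w \<longleftrightarrow> (u, w) \<in> cox_rel V E m"
  by (rule eq_equiv_class_iff[OF equiv_cox_rel])

lemma carrier_cox_group: "carrier (cox_group (V, E, m)) = cox_class V E m ` lists V"
  by (auto simp: cox_group_def quotient_def)

lemma one_cox_group: "\<one>\<^bsub>cox_group (V, E, m)\<^esub> = cox_class V E m []"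
  by (simp add: cox_group_def)

text \<open>All products of representatives lie in one class, so the union defining the
  multiplication consists of copies of that class.\<close>

lemma mult_cox_class:
  assumes "u \<in> lists V" "w \<in> lists V"
  shows "cox_class V E m u \<otimes>\<^bsub>cox_group (V, E, m)\<^esub> cox_class V E m w = cox_class V E m (u @ w)"
proof -
  have "cox_class V E m (a @ b) = cox_class V E m (u @ w)"
    if a: "a \<in> cox_class V E m u" and b: "b \<in> cox_class V E m w" for a b
  proof -
    have ab: "(u, a) \<in> cox_rel V E m" "(w, b) \<in> cox_rel V E m" using a b by auto
    then have l: "a \<in> lists V" "b \<in> lists V" using cox_rel_lists by blast+
    have "(u @ w, a @ w) \<in> cox_rel V E m" "(a @ w, a @ b) \<in> cox_rel V E m"
      using cox_rel_append[OF ab(1), of "[]" w] cox_rel_append[OF ab(2), of a "[]"] assms l by auto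
    then have "(u @ w, a @ b) \<in> cox_rel V E m" by (rule cox_rel.trans)
    then show ?thesis using cox_class_eq_iff[of "u @ w" V "a @ b" E m] assms l by simp
  qed
  then have "(\<Union>a\<in>cox_class V E m u. \<Union>b\<in>cox_class V E m w. cox_class V E m (a @ b))
      = (\<Union>a\<in>cox_class V E m u. \<Union>b\<in>cox_class V E m w. cox_class V E m (u @ w))"
    by (intro SUP_cong HOL.refl)
  moreover have "cox_class V E m u \<noteq> {}" "cox_class V E m w \<noteq> {}"
    using cox_rel.refl[OF assms(1)] cox_rel.refl[OF assms(2)] by blast+
  ultimately show ?thesis by (simp add: cox_group_def)
qed

text \<open>Generators are involutions, so reversing a word inverts it: the two copies of the first
  letter meet in the middle and cancel.\<close>

lemma cox_rel_rev: "w \<in> lists V \<Longrightarrow> (rev w @ w, []) \<in> cox_rel V E m"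
proof (induction w)
  case Nil
  then show ?case by (simp add: cox_rel.refl)
next
  case (Cons v w)
  then have w: "v \<in> V" "w \<in> lists V" by auto
  then have "(rev w @ [v, v] @ w, rev w @ w) \<in> cox_rel V E m" by (intro cox_rel.square) auto
  from cox_rel.trans[OF this Cons.IH[OF w(2)]] show ?case by simp
qed

lemma group_cox_group: "group (cox_group \<Gamma>)"
proof -
  obtain V E m where \<Gamma>: "\<Gamma> = (V, E, m)" by (cases \<Gamma>)
  have word: "\<exists>w\<in>lists V. x = cox_class V E m w" if "x \<in> carrier (cox_group (V, E, m))" for x
    using that unfolding carrier_cox_group by blast
  have mem: "cox_class V E m w \<in> carrier (cox_group (V, E, m))" if "w \<in> lists V" for w
    using that unfolding carrier_cox_group by blast
  have app: "u @ w \<in> lists V" if "u \<in> lists V" "w \<in> lists V" for u w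
    using that by simp
  have "group (cox_group (V, E, m))"
  proof (rule groupI)
    fix x y assume "x \<in> carrier (cox_group (V, E, m))" "y \<in> carrier (cox_group (V, E, m))"
    then show "x \<otimes>\<^bsub>cox_group (V, E, m)\<^esub> y \<in> carrier (cox_group (V, E, m))"
      by (metis word mem mult_cox_class app)
  next
    show "\<one>\<^bsub>cox_group (V, E, m)\<^esub> \<in> carrier (cox_group (V, E, m))"
      unfolding one_cox_group by (rule mem) simp
  next
    fix x y z
    assume "x \<in> carrier (cox_group (V, E, m))" "y \<in> carrier (cox_group (V, E, m))" "z \<in> carrier (cox_group (V, E, m))"
    then obtain u v w where "u \<in> lists V" "v \<in> lists V" "w \<in> lists V"
      "x = cox_class V E m u" "y = cox_class V E m v" "z = cox_class V E m w" using word by metis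
    then show "x \<otimes>\<^bsub>cox_group (V, E, m)\<^esub> y \<otimes>\<^bsub>cox_group (V, E, m)\<^esub> z
        = x \<otimes>\<^bsub>cox_group (V, E, m)\<^esub> (y \<otimes>\<^bsub>cox_group (V, E, m)\<^esub> z)"
      by (simp only: mult_cox_class app append_assoc)
  next
    fix x assume "x \<in> carrier (cox_group (V, E, m))"
    then obtain w where w: "w \<in> lists V" "x = cox_class V E m w" using word by blast
    show "\<one>\<^bsub>cox_group (V, E, m)\<^esub> \<otimes>\<^bsub>cox_group (V, E, m)\<^esub> x = x"
      using mult_cox_class[of "[]" V w E m] w by (simp add: one_cox_group)
    have rw: "rev w \<in> lists V" using w(1) by (simp add: in_lists_conv_set)
    have "cox_class V E m (rev w) \<otimes>\<^bsub>cox_group (V, E, m)\<^esub> x = \<one>\<^bsub>cox_group (V, E, m)\<^esub>"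
      using cox_rel_rev[OF w(1)] mult_cox_class[OF rw w(1), of E m] cox_class_eq_iff[of "rev w @ w" V "[]" E m] w rw
      by (simp add: one_cox_group)
    then show "\<exists>y\<in>carrier (cox_group (V, E, m)). y \<otimes>\<^bsub>cox_group (V, E, m)\<^esub> x = \<one>\<^bsub>cox_group (V, E, m)\<^esub>"
      using mem[OF rw] by blast
  qed
  then show ?thesis by (simp add: \<Gamma>)
qed

lemma cox_gens_eq: "cox_gens (V, E, m) = (\<lambda>v. cox_class V E m [v]) ` V"
  by (simp add: cox_gens_def)

lemma cox_gens_subset: "cox_gens \<Gamma> \<subseteq> carrier (cox_group \<Gamma>)"
  by (cases \<Gamma>) (auto simp: cox_gens_eq carrier_cox_group)

lemma generate_cox_gens: "generate (cox_group \<Gamma>) (cox_gens \<Gamma>) = carrier (cox_group \<Gamma>)"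
proof -
  obtain V E m where \<Gamma>: "\<Gamma> = (V, E, m)" by (cases \<Gamma>)
  have "cox_class V E m w \<in> generate (cox_group \<Gamma>) (cox_gens \<Gamma>)" if "w \<in> lists V" for w
    using that
  proof (induction w)
    case Nil
    then show ?case using generate.one[of "cox_group \<Gamma>"] by (simp add: \<Gamma> one_cox_group)
  next
    case (Cons v w)
    then have "cox_class V E m [v] \<in> generate (cox_group \<Gamma>) (cox_gens \<Gamma>)"
      by (auto simp: \<Gamma> cox_gens_eq intro: generate.incl)
    from generate.eng[OF this Cons.IH] Cons.hyps
    show ?case using mult_cox_class[of "[v]" V w E m] by (simp add: \<Gamma>)
  qed
  then show ?thesis
    using group.generate_incl[OF group_cox_group cox_gens_subset, of \<Gamma>] by (auto simp: \<Gamma> carrier_cox_group)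
qed

section \<open>The universal property of the presentation\<close>

definition word_prod :: "('a, 'b) monoid_scheme \<Rightarrow> (nat \<Rightarrow> 'a) \<Rightarrow> nat list \<Rightarrow> 'a" where
  "word_prod X f w = foldr (\<lambda>v y. f v \<otimes>\<^bsub>X\<^esub> y) w \<one>\<^bsub>X\<^esub>"

text \<open>Once \<open>f\<close> satisfies the relators, \<open>word_prod X f\<close> is constant
  on each class, so the image of a class is a singleton and \<open>the_elem\<close> extracts its
  value.\<close>

definition cox_lift :: "('a, 'b) monoid_scheme \<Rightarrow> (nat \<Rightarrow> 'a) \<Rightarrow> nat list set \<Rightarrow> 'a" where
  "cox_lift X f C = the_elem (word_prod X f ` C)"

lemma cox_lift:
  assumes X: "group X" and f: "\<And>v. v \<in> V \<Longrightarrow> f v \<in> carrier X"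
    and sq: "\<And>v. v \<in> V \<Longrightarrow> f v \<otimes>\<^bsub>X\<^esub> f v = \<one>\<^bsub>X\<^esub>"
    and br: "\<And>v w. v \<in> V \<Longrightarrow> w \<in> V \<Longrightarrow> {v, w} \<in> E \<Longrightarrow> (f v \<otimes>\<^bsub>X\<^esub> f w) [^]\<^bsub>X\<^esub> m {v, w} = \<one>\<^bsub>X\<^esub>"
  shows "cox_lift X f \<in> hom (cox_group (V, E, m)) X"
    "\<And>v. v \<in> V \<Longrightarrow> cox_lift X f (cox_class V E m [v]) = f v"
proof -
  interpret X: group X by fact
  have cl: "word_prod X f w \<in> carrier X" if "w \<in> lists V" for w
    using that by (induction w) (auto simp: word_prod_def f)
  have app: "word_prod X f (u @ w) = word_prod X f u \<otimes>\<^bsub>X\<^esub> word_prod X f w"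
    if "u \<in> lists V" "w \<in> lists V" for u w
    using that(1)
  proof (induction u)
    case Nil
    then show ?case using cl[OF that(2)] by (simp add: word_prod_def)
  next
    case (Cons v u)
    then show ?case using cl[OF that(2)] cl[of u] f[of v] by (simp add: word_prod_def X.m_assoc)
  qed
  have pow: "concat (replicate n [v, w]) \<in> lists V \<and> word_prod X f (concat (replicate n [v, w])) = (f v \<otimes>\<^bsub>X\<^esub> f w) [^]\<^bsub>X\<^esub> n"
    if "v \<in> V" "w \<in> V" for v w and n :: nat
  proof (induction n)
    case 0
    then show ?case by (simp add: word_prod_def)
  next
    case (Suc n)
    then show ?case using that f[of v] f[of w] X.nat_pow_Suc2[of "f v \<otimes>\<^bsub>X\<^esub> f w" n]
      by (simp add: word_prod_def X.m_assoc)
  qed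
  have inv: "word_prod X f u = word_prod X f w" if "(u, w) \<in> cox_rel V E m" for u w
    using that
  proof (induction rule: cox_rel.induct)
    case (square xs ys v)
    then have "word_prod X f ([v, v] @ ys) = word_prod X f ys"
      using f[of v] sq[of v] cl[of ys] by (simp add: word_prod_def X.m_assoc[symmetric])
    then show ?case using square app[of xs "[v, v] @ ys"] app[of xs ys] by simp
  next
    case (braid xs ys v w)
    then show ?case using pow[of v w "m {v, w}"] br[of v w] cl[of xs] cl[of ys]
        app[of xs "concat (replicate (m {v, w}) [v, w]) @ ys"] app[of "concat (replicate (m {v, w}) [v, w])" ys] app[of xs ys]
      by simp
  qed auto
  have lift: "cox_lift X f (cox_class V E m w) = word_prod X f w" if "w \<in> lists V" for w
  proof -
    have "word_prod X f ` cox_class V E m w = {word_prod X f w}"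
    proof (intro equalityI subsetI)
      show "x \<in> {word_prod X f w}" if "x \<in> word_prod X f ` cox_class V E m w" for x
        using that inv by auto
      show "x \<in> word_prod X f ` cox_class V E m w" if "x \<in> {word_prod X f w}" for x
        using that cox_rel.refl[OF \<open>w \<in> lists V\<close>] by blast
    qed
    then show ?thesis by (simp add: cox_lift_def)
  qed
  show "cox_lift X f \<in> hom (cox_group (V, E, m)) X"
  proof (rule homI)
    fix x assume "x \<in> carrier (cox_group (V, E, m))"
    then obtain u where u: "u \<in> lists V" "x = cox_class V E m u" unfolding carrier_cox_group by blast
    then show "cox_lift X f x \<in> carrier X" using lift cl by simp
    fix y assume "y \<in> carrier (cox_group (V, E, m))"
    then obtain w where w: "w \<in> lists V" "y = cox_class V E m w" unfolding carrier_cox_group by blast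
    show "cox_lift X f (x \<otimes>\<^bsub>cox_group (V, E, m)\<^esub> y) = cox_lift X f x \<otimes>\<^bsub>X\<^esub> cox_lift X f y"
      using lift[of "u @ w"] lift[OF u(1)] lift[OF w(1)] app[OF u(1) w(1)] u w mult_cox_class[OF u(1) w(1), of E m] by simp
  qed
  show "cox_lift X f (cox_class V E m [v]) = f v" if "v \<in> V" for v
    using lift[of "[v]"] that f[OF that] by (simp add: word_prod_def)
qed

lemma cox_class_square:
  assumes "v \<in> V"
  shows "cox_class V E m [v] \<otimes>\<^bsub>cox_group (V, E, m)\<^esub> cox_class V E m [v] = \<one>\<^bsub>cox_group (V, E, m)\<^esub>"
  using assms cox_rel.square[of "[]" V "[]" v E m]
  by (simp add: mult_cox_class one_cox_group cox_class_eq_iff)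

lemma cox_class_braid:
  assumes "v \<in> V" "w \<in> V" "{v, w} \<in> E"
  shows "(cox_class V E m [v] \<otimes>\<^bsub>cox_group (V, E, m)\<^esub> cox_class V E m [w]) [^]\<^bsub>cox_group (V, E, m)\<^esub> m {v, w}
    = \<one>\<^bsub>cox_group (V, E, m)\<^esub>"
proof -
  interpret group "cox_group (V, E, m)" by (rule group_cox_group)
  have "(cox_class V E m [v] \<otimes>\<^bsub>cox_group (V, E, m)\<^esub> cox_class V E m [w]) [^]\<^bsub>cox_group (V, E, m)\<^esub> n
      = cox_class V E m (concat (replicate n [v, w])) \<and> concat (replicate n [v, w]) \<in> lists V" for n
  proof (induction n)
    case 0
    then show ?case by (simp add: one_cox_group)
  next
    case (Suc n)
    have "cox_class V E m [v, w] \<in> carrier (cox_group (V, E, m))"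
      using assms by (auto simp: carrier_cox_group)
    then show ?case using Suc assms mult_cox_class[of "[v, w]" V "concat (replicate n [v, w])" E m]
        nat_pow_Suc2[of "cox_class V E m [v, w]" n]
      by (simp add: mult_cox_class)
  qed
  then show ?thesis using cox_rel.braid[of "[]" V "[]" v w E m] assms
    by (simp add: one_cox_group cox_class_eq_iff)
qed

section \<open>Joining two new vertices to a Coxeter graph\<close>

text \<open>For fresh \<open>a\<close> and \<open>b\<close> the set \<open>{a, b}\<close> is not an
  edge, so no relation bounds the order of their product. The test \<open>e \<subseteq> V\<close>
  tells old edges, which keep their label, from new ones.\<close>

definition join_dihedral :: "nat \<Rightarrow> nat \<Rightarrow> cox_graph \<Rightarrow> cox_graph" where
  "join_dihedral a b \<Gamma> = (case \<Gamma> of (V, E, m) \<Rightarrow>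
     (V \<union> {a, b}, E \<union> {{x, v} | x v. x \<in> {a, b} \<and> v \<in> V}, \<lambda>e. if e \<subseteq> V then m e else 2))"

lemma coxeter_graph_join_dihedral:
  assumes "coxeter_graph (V, E, m)" "a \<notin> V" "b \<notin> V"
  shows "coxeter_graph (join_dihedral a b (V, E, m))"
proof -
  have "card {x, v} = 2" if "x \<in> {a, b}" "v \<in> V" for x v
    using that assms(2,3) by (auto simp: card_insert_if)
  then show ?thesis using assms by (auto simp: coxeter_graph_def join_dihedral_def)
qed

text \<open>The universal properties of the presentation and of the dihedral group give
  homomorphisms in both directions, which are inverse because they are so on generators. The image
  of the generating set is recorded because one-endedness refers to a particular Cayley
  graph.\<close>

lemma cox_group_join_dihedral:
  assumes \<Gamma>: "coxeter_graph (V, E, m)" and ab: "a \<notin> V" "b \<notin> V" "a \<noteq> b"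
  obtains F where "F \<in> iso (cox_group (join_dihedral a b (V, E, m))) (cox_group (V, E, m) \<times>\<times> inf_dihedral)"
    "F ` cox_gens (join_dihedral a b (V, E, m)) =
      cox_gens (V, E, m) \<times> {\<one>\<^bsub>inf_dihedral\<^esub>} \<union> {\<one>\<^bsub>cox_group (V, E, m)\<^esub>} \<times> {(0, True), (1, True)}"
proof -
  define V' where "V' = V \<union> {a, b}"
  define E' where "E' = E \<union> {{x, v} | x v. x \<in> {a, b} \<and> v \<in> V}"
  define m' where "m' = (\<lambda>e. if e \<subseteq> V then m e else 2)"
  have join: "join_dihedral a b (V, E, m) = (V', E', m')"
    by (simp add: join_dihedral_def V'_def E'_def m'_def)
  define W where "W = cox_group (V, E, m)"
  define W' where "W' = cox_group (V', E', m')"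
  let ?P = "W \<times>\<times> inf_dihedral"
  let ?c = "\<lambda>v. cox_class V E m [v]" and ?c' = "\<lambda>v. cox_class V' E' m' [v]"
  have W: "group W" and W': "group W'" by (simp_all add: W_def W'_def group_cox_group)
  have P: "group ?P" by (rule DirProd_group[OF W group_inf_dihedral])
  interpret W: group W by fact
  interpret W': group W' by fact
  interpret P: group ?P by fact
  have c: "?c v \<in> carrier W" if "v \<in> V" for v using that by (auto simp: W_def carrier_cox_group)
  have c': "?c' v \<in> carrier W'" if "v \<in> V'" for v using that by (auto simp: W'_def carrier_cox_group)
  have sq: "?c v \<otimes>\<^bsub>W\<^esub> ?c v = \<one>\<^bsub>W\<^esub>" if "v \<in> V" for v using cox_class_square[OF that] by (simp add: W_def)
  have sq': "?c' v \<otimes>\<^bsub>W'\<^esub> ?c' v = \<one>\<^bsub>W'\<^esub>" if "v \<in> V'" for v using cox_class_square[OF that] by (simp add: W'_def)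
  have EV: "e \<subseteq> V" if "e \<in> E" for e using \<Gamma> that by (auto simp: coxeter_graph_def)
  \<comment> \<open>For involutions, the relator with exponent 2 says exactly that they
    commute.\<close>
  have comm': "?c' x \<otimes>\<^bsub>W'\<^esub> ?c' v = ?c' v \<otimes>\<^bsub>W'\<^esub> ?c' x" if x: "x \<in> {a, b}" and v: "v \<in> V" for x v
  proof -
    have xv: "x \<in> V'" "v \<in> V'" "{x, v} \<in> E'" "m' {x, v} = 2"
      using x v ab by (auto simp: V'_def E'_def m'_def)
    have "(?c' x \<otimes>\<^bsub>W'\<^esub> ?c' v) [^]\<^bsub>W'\<^esub> (2::nat) = \<one>\<^bsub>W'\<^esub>"
      using cox_class_braid[OF xv(1-3), of m'] xv(4) by (simp add: W'_def)
    then have "(?c' x \<otimes>\<^bsub>W'\<^esub> ?c' v) \<otimes>\<^bsub>W'\<^esub> (?c' x \<otimes>\<^bsub>W'\<^esub> ?c' v) = \<one>\<^bsub>W'\<^esub>"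
      using c' xv by (simp add: numeral_2_eq_2)
    then have "inv\<^bsub>W'\<^esub> (?c' x \<otimes>\<^bsub>W'\<^esub> ?c' v) = ?c' x \<otimes>\<^bsub>W'\<^esub> ?c' v"
      using c' xv W'.inv_equality by simp
    moreover have "inv\<^bsub>W'\<^esub> ?c' x = ?c' x" "inv\<^bsub>W'\<^esub> ?c' v = ?c' v"
      using c' sq' xv W'.inv_equality by simp_all
    ultimately show ?thesis using c' xv by (simp add: W'.inv_mult_group)
  qed
  \<comment> \<open>The new vertices go to the two reflections that generate the dihedral group, the
    old ones to their own classes in the first factor.\<close>
  define f where "f v = (if v = a then (\<one>\<^bsub>W\<^esub>, (0, True)) else if v = b then (\<one>\<^bsub>W\<^esub>, (1, True)) else (?c v, (0 :: int, False)))" for v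
  have fV: "f v = (?c v, \<one>\<^bsub>inf_dihedral\<^esub>)" if "v \<in> V" for v using that ab by (auto simp: f_def)
  have fab: "fst (f x) = \<one>\<^bsub>W\<^esub> \<and> snd (f x) \<otimes>\<^bsub>inf_dihedral\<^esub> snd (f x) = \<one>\<^bsub>inf_dihedral\<^esub>" if "x \<in> {a, b}" for x
    using that by (auto simp: f_def)
  have fc: "f v \<in> carrier ?P" if "v \<in> V'" for v
    using that c by (auto simp: f_def V'_def)
  have fsq: "f v \<otimes>\<^bsub>?P\<^esub> f v = \<one>\<^bsub>?P\<^esub>" if "v \<in> V'" for v
    using that sq ab by (auto simp: f_def V'_def mult_DirProd')
  \<comment> \<open>The images commute and are involutions, so their product squares to the
    identity. Both orders are covered because an edge is an unordered pair.\<close>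
  have fmix: "(f v \<otimes>\<^bsub>?P\<^esub> f w) [^]\<^bsub>?P\<^esub> (2::nat) = \<one>\<^bsub>?P\<^esub>"
    if "v \<in> {a, b} \<and> w \<in> V \<or> w \<in> {a, b} \<and> v \<in> V" for v w
  proof -
    have "v \<in> V'" "w \<in> V'" using that by (auto simp: V'_def)
    have comm: "f v \<otimes>\<^bsub>?P\<^esub> f w = f w \<otimes>\<^bsub>?P\<^esub> f v"
      using that
    proof
      assume h: "v \<in> {a, b} \<and> w \<in> V"
      then show ?thesis using fab[of v] fV[of w] c[of w] by (cases "snd (f v)") (simp add: mult_DirProd')
    next
      assume h: "w \<in> {a, b} \<and> v \<in> V"
      then show ?thesis using fab[of w] fV[of v] c[of v] by (cases "snd (f w)") (simp add: mult_DirProd')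
    qed
    have "(f v \<otimes>\<^bsub>?P\<^esub> f w) [^]\<^bsub>?P\<^esub> (2::nat) = (f v \<otimes>\<^bsub>?P\<^esub> f w) \<otimes>\<^bsub>?P\<^esub> (f v \<otimes>\<^bsub>?P\<^esub> f w)"
      using fc[OF \<open>v \<in> V'\<close>] fc[OF \<open>w \<in> V'\<close>] P.m_closed by (simp only: numeral_2_eq_2 P.nat_pow_Suc P.nat_pow_0 P.l_one)
    also have "\<dots> = (f v \<otimes>\<^bsub>?P\<^esub> f w) \<otimes>\<^bsub>?P\<^esub> (f w \<otimes>\<^bsub>?P\<^esub> f v)" using comm by simp
    also have "\<dots> = f v \<otimes>\<^bsub>?P\<^esub> (f w \<otimes>\<^bsub>?P\<^esub> f w) \<otimes>\<^bsub>?P\<^esub> f v"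
      using fc[OF \<open>v \<in> V'\<close>] fc[OF \<open>w \<in> V'\<close>] by (simp only: P.m_assoc P.m_closed)
    also have "\<dots> = \<one>\<^bsub>?P\<^esub>" unfolding fsq[OF \<open>w \<in> V'\<close>]
      using fc[OF \<open>v \<in> V'\<close>] fsq[OF \<open>v \<in> V'\<close>] by (simp only: P.r_one)
    finally show ?thesis .
  qed
  have fbr: "(f v \<otimes>\<^bsub>?P\<^esub> f w) [^]\<^bsub>?P\<^esub> m' {v, w} = \<one>\<^bsub>?P\<^esub>"
    if edge: "v \<in> V'" "w \<in> V'" "{v, w} \<in> E'" for v w
  proof (cases "{v, w} \<in> E")
    case True
    then have vw: "v \<in> V" "w \<in> V" using EV by auto
    have "(?c v \<otimes>\<^bsub>W\<^esub> ?c w) [^]\<^bsub>W\<^esub> m {v, w} = \<one>\<^bsub>W\<^esub>"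
      using cox_class_braid[OF vw True, of m] by (simp add: W_def)
    moreover have "m' {v, w} = m {v, w}" using vw by (simp add: m'_def)
    moreover have "\<one>\<^bsub>inf_dihedral\<^esub> [^]\<^bsub>inf_dihedral\<^esub> n = \<one>\<^bsub>inf_dihedral\<^esub>" for n :: nat
      using group.is_monoid[OF group_inf_dihedral] by (rule monoid.nat_pow_one)
    ultimately show ?thesis using fV[OF vw(1)] fV[OF vw(2)] by (simp add: DirProd_nat_pow)
  next
    case False
    then obtain x u where "{v, w} = {x, u}" "x \<in> {a, b}" "u \<in> V" using edge(3) by (auto simp: E'_def)
    then have h: "v \<in> {a, b} \<and> w \<in> V \<or> w \<in> {a, b} \<and> v \<in> V" by (auto simp: doubleton_eq_iff)
    then have "m' {v, w} = 2" using ab by (auto simp: m'_def)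
    then show ?thesis using fmix[OF h] by simp
  qed
  define F where "F = cox_lift ?P f"
  have Fl: "F \<in> hom W' ?P" "\<And>v. v \<in> V' \<Longrightarrow> F (?c' v) = f v"
    unfolding F_def W'_def
    by (rule cox_lift(1), rule P, erule fc, erule fsq, erule (2) fbr)
      (rule cox_lift(2), rule P, erule fc, erule fsq, erule (2) fbr, assumption)
  have i_br: "(?c' v \<otimes>\<^bsub>W'\<^esub> ?c' w) [^]\<^bsub>W'\<^esub> m {v, w} = \<one>\<^bsub>W'\<^esub>" if "v \<in> V" "w \<in> V" "{v, w} \<in> E" for v w
    using cox_class_braid[of v V' w E' m'] that by (simp add: V'_def E'_def m'_def W'_def)
  have VV': "v \<in> V'" if "v \<in> V" for v using that by (simp add: V'_def)
  define i where "i = cox_lift W' ?c'"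
  have il: "i \<in> hom W W'" "\<And>v. v \<in> V \<Longrightarrow> i (?c v) = ?c' v"
    unfolding i_def W_def
    by (rule cox_lift(1), rule W', erule c'[OF VV'], erule sq'[OF VV'], erule (2) i_br)
      (rule cox_lift(2), rule W', erule c'[OF VV'], erule sq'[OF VV'], erule (2) i_br, assumption)
  define j where "j = dihedral_lift W' (?c' a) (?c' b)"
  have abV': "a \<in> V'" "b \<in> V'" by (simp_all add: V'_def)
  note jl = dihedral_lift[OF W' c'[OF abV'(1)] sq'[OF abV'(1)] c'[OF abV'(2)] sq'[OF abV'(2)], folded j_def]
  have genW: "generate W (cox_gens (V, E, m)) = carrier W" "cox_gens (V, E, m) \<subseteq> carrier W"
    using generate_cox_gens cox_gens_subset by (auto simp: W_def)
  have genW': "generate W' (cox_gens (V', E', m')) = carrier W'" "cox_gens (V', E', m') \<subseteq> carrier W'"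
    using generate_cox_gens cox_gens_subset by (auto simp: W'_def)
  have gensD: "{(0, True), (1, True)} \<subseteq> carrier inf_dihedral" by simp
  have ic: "i w \<in> carrier W'" if "w \<in> carrier W" for w using hom_in_carrier[OF il(1) that] .
  have jc: "j d \<in> carrier W'" for d using hom_in_carrier[OF jl(1), of d] by simp
  \<comment> \<open>Commutation of the two images is what makes \<open>B\<close> multiplicative. It
    is reduced to generators first in \<open>w\<close> and then in \<open>d\<close>.\<close>
  have comm_ij: "i w \<otimes>\<^bsub>W'\<^esub> j d = j d \<otimes>\<^bsub>W'\<^esub> i w" if w: "w \<in> carrier W" for w d
  proof (rule commute_on_generate[OF W W' il(1) genW(2) _ jc])
    show "w \<in> generate W (cox_gens (V, E, m))" using w genW by simp
    fix s assume "s \<in> cox_gens (V, E, m)"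
    then obtain v where v: "v \<in> V" "s = ?c v" by (auto simp: cox_gens_eq)
    then have i_s: "i s = ?c' v" using il(2) by simp
    have "j d \<otimes>\<^bsub>W'\<^esub> ?c' v = ?c' v \<otimes>\<^bsub>W'\<^esub> j d"
    proof (rule commute_on_generate[OF group_inf_dihedral W' jl(1) gensD _ c'[OF VV'[OF v(1)]]])
      show "d \<in> generate inf_dihedral {(0, True), (1, True)}" by (simp add: generate_inf_dihedral)
      fix t :: "int \<times> bool" assume "t \<in> {(0, True), (1, True)}"
      then show "j t \<otimes>\<^bsub>W'\<^esub> ?c' v = ?c' v \<otimes>\<^bsub>W'\<^esub> j t"
        using jl(2,3) comm'[OF _ v(1)] by auto
    qed
    then show "i s \<otimes>\<^bsub>W'\<^esub> j d = j d \<otimes>\<^bsub>W'\<^esub> i s" by (simp add: i_s)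
  qed
  define B where "B = (\<lambda>(w, d). i w \<otimes>\<^bsub>W'\<^esub> j d)"
  have Bhom: "B \<in> hom ?P W'"
  proof (rule homI)
    show "B x \<in> carrier W'" if "x \<in> carrier ?P" for x using that ic jc by (auto simp: B_def)
    fix x y assume "x \<in> carrier ?P" "y \<in> carrier ?P"
    then obtain w d w2 d2 where xy: "x = (w, d)" "y = (w2, d2)" "w \<in> carrier W" "w2 \<in> carrier W" by auto
    have "B (x \<otimes>\<^bsub>?P\<^esub> y) = i w \<otimes>\<^bsub>W'\<^esub> (i w2 \<otimes>\<^bsub>W'\<^esub> j d) \<otimes>\<^bsub>W'\<^esub> j d2"
      using xy hom_mult[OF il(1) xy(3,4)] hom_mult[OF jl(1), of d d2] ic jc
      by (simp add: B_def mult_DirProd' W'.m_assoc)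
    also have "\<dots> = B x \<otimes>\<^bsub>W'\<^esub> B y"
      unfolding comm_ij[OF xy(4)] using xy ic jc by (simp add: B_def W'.m_assoc)
    finally show "B (x \<otimes>\<^bsub>?P\<^esub> y) = B x \<otimes>\<^bsub>W'\<^esub> B y" .
  qed
  have i1: "i \<one>\<^bsub>W\<^esub> = \<one>\<^bsub>W'\<^esub>" and j1: "j (0, False) = \<one>\<^bsub>W'\<^esub>"
    using hom_one[OF il(1) W W'] hom_one[OF jl(1) group_inf_dihedral W'] by simp_all
  have BF: "B (F x) = x" if x: "x \<in> carrier W'" for x
  proof -
    have "(B \<circ> F) x = id x"
    proof (rule hom_eq_on_generate[OF W' W' hom_compose[OF Fl(1) Bhom] _ genW'(2)])
      show "id \<in> hom W' W'" by (simp add: hom_def)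
      show "x \<in> generate W' (cox_gens (V', E', m'))" using x genW' by simp
      fix s assume "s \<in> cox_gens (V', E', m')"
      then obtain v where v: "v \<in> V'" "s = ?c' v" by (auto simp: cox_gens_eq)
      then have "F s = f v" using Fl(2) by simp
      moreover consider "v = a" | "v = b" | "v \<in> V" using v by (auto simp: V'_def)
      then have "B (f v) = ?c' v"
        using il(2)[of v] jl c' abV' VV' ab by cases (auto simp: f_def B_def i1 j1)
      ultimately show "(B \<circ> F) s = id s" using v by simp
    qed
    then show ?thesis by simp
  qed
  \<comment> \<open>\<open>F\<close> after \<open>i\<close> and \<open>F\<close> after
    \<open>j\<close> are the two coordinate inclusions, and their product is the identity; this
    gives \<open>FB\<close>.\<close>
  have Fi: "F (i w) = (w, \<one>\<^bsub>inf_dihedral\<^esub>)" if w: "w \<in> carrier W" for w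
  proof -
    have "(F \<circ> i) w = (\<lambda>w. (w, \<one>\<^bsub>inf_dihedral\<^esub>)) w"
    proof (rule hom_eq_on_generate[OF W P hom_compose[OF il(1) Fl(1)] prod_homs(3)[OF W group_inf_dihedral] genW(2)])
      show "w \<in> generate W (cox_gens (V, E, m))" using w genW by simp
      fix s assume "s \<in> cox_gens (V, E, m)"
      then obtain v where v: "v \<in> V" "s = ?c v" by (auto simp: cox_gens_eq)
      then show "(F \<circ> i) s = (s, \<one>\<^bsub>inf_dihedral\<^esub>)" using il(2) Fl(2)[OF VV'[OF v(1)]] fV by simp
    qed
    then show ?thesis by simp
  qed
  have Fj: "F (j d) = (\<one>\<^bsub>W\<^esub>, d)" for d
  proof -
    have "(F \<circ> j) d = (\<lambda>d. (\<one>\<^bsub>W\<^esub>, d)) d"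
    proof (rule hom_eq_on_generate[OF group_inf_dihedral P hom_compose[OF jl(1) Fl(1)] prod_homs(4)[OF W group_inf_dihedral] gensD])
      show "d \<in> generate inf_dihedral {(0, True), (1, True)}" by (simp add: generate_inf_dihedral)
      fix s :: "int \<times> bool" assume "s \<in> {(0, True), (1, True)}"
      then show "(F \<circ> j) s = (\<one>\<^bsub>W\<^esub>, s)" using jl(2,3) Fl(2)[OF abV'(1)] Fl(2)[OF abV'(2)] ab by (auto simp: f_def)
    qed
    then show ?thesis by simp
  qed
  have FB: "F (B x) = x" if xP: "x \<in> carrier ?P" for x
  proof -
    obtain w d where x: "x = (w, d)" "w \<in> carrier W" using xP by auto
    then show ?thesis using hom_mult[OF Fl(1) ic[OF x(2)] jc[of d]] Fi[OF x(2)] Fj[of d]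
        group.is_monoid[OF group_inf_dihedral] monoid.l_one[of inf_dihedral d]
      by (simp add: B_def mult_DirProd')
  qed
  have "F \<in> iso W' ?P"
    by (rule iso_by_inverse[OF Fl(1) _ HOL.refl BF FB]) (use Bhom in \<open>auto simp: hom_def\<close>)
  moreover have "F ` cox_gens (V', E', m') = f ` V'"
    using Fl(2) by (simp add: cox_gens_eq image_image)
  moreover have "f ` V' = f ` V \<union> {f a, f b}" by (auto simp: V'_def)
  moreover have "f ` V = cox_gens (V, E, m) \<times> {\<one>\<^bsub>inf_dihedral\<^esub>}"
    using fV by (auto simp: cox_gens_eq image_iff)
  moreover have "{f a, f b} = {\<one>\<^bsub>W\<^esub>} \<times> {(0, True), (1, True)}"
    using ab by (auto simp: f_def)
  ultimately show thesis using that[of F] by (simp add: join W_def W'_def)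
qed

section \<open>Adding a dihedral factor and descending rigidity\<close>

text \<open>Two consecutive numbers above every vertex are fresh; the inserted 0 keeps
  \<open>Max\<close> meaningful when the graph is empty.\<close>

definition add_dihedral :: "cox_graph \<Rightarrow> cox_graph" where
  "add_dihedral \<Gamma> = (let a = Suc (Max (insert 0 (fst \<Gamma>))) in join_dihedral a (Suc a) \<Gamma>)"

lemma add_dihedral:
  assumes "coxeter_graph \<Gamma>"
  obtains a b where "add_dihedral \<Gamma> = join_dihedral a b \<Gamma>" "a \<notin> fst \<Gamma>" "b \<notin> fst \<Gamma>" "a \<noteq> b"
proof -
  have fin: "finite (fst \<Gamma>)" using assms by (cases \<Gamma>) (auto simp: coxeter_graph_def)
  let ?a = "Suc (Max (insert 0 (fst \<Gamma>)))"
  have "v < ?a" if "v \<in> fst \<Gamma>" for v using fin that by (intro le_imp_less_Suc Max_ge) auto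
  then have "?a \<notin> fst \<Gamma>" "Suc ?a \<notin> fst \<Gamma>" by (metis less_irrefl, metis Suc_lessD less_irrefl)
  then show thesis using that[of ?a "Suc ?a"] by (simp add: add_dihedral_def Let_def)
qed

lemma coxeter_graph_add_dihedral: "coxeter_graph \<Gamma> \<Longrightarrow> coxeter_graph (add_dihedral \<Gamma>)"
  using coxeter_graph_join_dihedral by (metis add_dihedral prod_cases3 fst_conv)

lemma iso_add_dihedral:
  assumes "coxeter_graph \<Gamma>"
  obtains F where "F \<in> iso (cox_group (add_dihedral \<Gamma>)) (cox_group \<Gamma> \<times>\<times> inf_dihedral)"
    "F ` cox_gens (add_dihedral \<Gamma>) =
      cox_gens \<Gamma> \<times> {\<one>\<^bsub>inf_dihedral\<^esub>} \<union> {\<one>\<^bsub>cox_group \<Gamma>\<^esub>} \<times> {(0, True), (1, True)}"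
proof -
  obtain V E m where \<Gamma>: "\<Gamma> = (V, E, m)" by (cases \<Gamma>)
  obtain a b where ab: "add_dihedral \<Gamma> = join_dihedral a b \<Gamma>" "a \<notin> V" "b \<notin> V" "a \<noteq> b"
    using add_dihedral[OF assms] by (auto simp: \<Gamma>)
  show thesis
    using cox_group_join_dihedral[OF assms[unfolded \<Gamma>] ab(2-4)] that unfolding ab(1) unfolding \<Gamma> by blast
qed

lemma cox_group_add_dihedral:
  assumes "coxeter_graph \<Gamma>"
  shows "cox_group (add_dihedral \<Gamma>) \<cong> cox_group \<Gamma> \<times>\<times> inf_dihedral"
  using iso_add_dihedral[OF assms] unfolding is_iso_def by blast

lemma infinite_inf_dihedral: "infinite (carrier inf_dihedral)"
  by (simp add: finite_prod infinite_UNIV_int)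

lemma infinite_cox_group_add_dihedral:
  assumes "coxeter_graph \<Gamma>"
  shows "infinite (carrier (cox_group (add_dihedral \<Gamma>)))"
proof -
  have "infinite (carrier (cox_group \<Gamma>) \<times> carrier inf_dihedral)"
    using infinite_inf_dihedral group.is_monoid[OF group_cox_group, of \<Gamma>] monoid.one_closed
    by (metis empty_iff finite_cartesian_productD2)
  then show ?thesis using iso_finite[OF cox_group_add_dihedral[OF assms]] by simp
qed

text \<open>Infinitude of the old group is essential: a finite group times the infinite dihedral
  group has two ends. A first dihedral factor supplies it before a second one is added.\<close>

lemma one_ended_add_dihedral:
  assumes "coxeter_graph \<Gamma>" "infinite (carrier (cox_group \<Gamma>))"
  shows "one_ended (cox_group (add_dihedral \<Gamma>)) (cox_gens (add_dihedral \<Gamma>))"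
proof -
  obtain F where F: "F \<in> iso (cox_group (add_dihedral \<Gamma>)) (cox_group \<Gamma> \<times>\<times> inf_dihedral)"
    "F ` cox_gens (add_dihedral \<Gamma>) =
      cox_gens \<Gamma> \<times> {\<one>\<^bsub>inf_dihedral\<^esub>} \<union> {\<one>\<^bsub>cox_group \<Gamma>\<^esub>} \<times> {(0, True), (1, True)}"
    using iso_add_dihedral[OF assms(1)] .
  show ?thesis
  proof (rule one_ended_product[OF group_cox_group group_cox_group group_inf_dihedral F(1) cox_gens_subset
        cox_gens_subset generate_cox_gens _ _ _ _ assms(2) infinite_inf_dihedral])
    show "generate inf_dihedral {(0, True), (1, True)} = carrier inf_dihedral"
      by (simp add: generate_inf_dihedral)
  qed (use F(2) in auto)
qed

lemma prof_iso_add_dihedral: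
  assumes \<Gamma>: "coxeter_graph \<Gamma>" and \<Delta>: "coxeter_graph \<Delta>" and iso: "prof_iso (cox_group \<Delta>) (cox_group \<Gamma>)"
  shows "prof_iso (cox_group (add_dihedral \<Delta>)) (cox_group (add_dihedral \<Gamma>))"
proof -
  note g = group_cox_group and d = DirProd_group[OF group_cox_group group_inf_dihedral]
  have 1: "prof_iso (cox_group (add_dihedral \<Delta>)) (cox_group \<Delta> \<times>\<times> inf_dihedral)"
    by (rule iso_imp_prof_iso[OF g d cox_group_add_dihedral[OF \<Delta>]])
  have 2: "prof_iso (cox_group \<Delta> \<times>\<times> inf_dihedral) (cox_group \<Gamma> \<times>\<times> inf_dihedral)"
    by (rule prof_iso_DirProd[OF g g group_inf_dihedral iso])
  have 3: "prof_iso (cox_group \<Gamma> \<times>\<times> inf_dihedral) (cox_group (add_dihedral \<Gamma>))"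
    by (rule iso_imp_prof_iso[OF d g group.iso_sym[OF g cox_group_add_dihedral[OF \<Gamma>]]])
  show ?thesis by (rule prof_iso_trans[OF prof_iso_trans[OF 1 2] 3])
qed

lemma iso_add_dihedral_cancel:
  assumes \<Gamma>: "coxeter_graph \<Gamma>" and \<Delta>: "coxeter_graph \<Delta>"
    and iso: "cox_group (add_dihedral \<Gamma>) \<cong> cox_group (add_dihedral \<Delta>)"
  shows "cox_group \<Gamma> \<cong> cox_group \<Delta>"
proof (rule direct_factor_cancel[OF group_cox_group group_cox_group group_inf_dihedral
      commuting_indecomposable_inf_dihedral])
  show "carrier inf_dihedral \<noteq> {\<one>\<^bsub>inf_dihedral\<^esub>}"
    using infinite_inf_dihedral by (metis finite.emptyI finite_insert)
  have "cox_group \<Gamma> \<times>\<times> inf_dihedral \<cong> cox_group (add_dihedral \<Gamma>)"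
    by (rule group.iso_sym[OF group_cox_group cox_group_add_dihedral[OF \<Gamma>]])
  also note iso
  also note cox_group_add_dihedral[OF \<Delta>]
  finally show "cox_group \<Gamma> \<times>\<times> inf_dihedral \<cong> cox_group \<Delta> \<times>\<times> inf_dihedral" .
qed

text \<open>The map \<open>add_dihedral\<close> carries the graphs counted for
  \<open>\<Gamma>\<close> to graphs counted for \<open>add_dihedral \<Gamma>\<close>, and by
  cancellation it separates isomorphism classes; so the classes for \<open>\<Gamma>\<close> inject
  into a finite set.\<close>

lemma almost_prof_rigid_add_dihedralD:
  assumes \<Gamma>: "coxeter_graph \<Gamma>" and rigid: "almost_prof_rigid (add_dihedral \<Gamma>)"
  shows "almost_prof_rigid \<Gamma>"
proof -
  define R where "R = {(\<Gamma>1, \<Gamma>2). cox_group \<Gamma>1 \<cong> cox_group \<Gamma>2}"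
  define X where "X \<Gamma> = {\<Delta>. coxeter_graph \<Delta> \<and> prof_iso (cox_group \<Delta>) (cox_group \<Gamma>)}" for \<Gamma>
  have rig: "almost_prof_rigid \<Gamma> \<longleftrightarrow> finite ((\<lambda>\<Delta>. R `` {\<Delta>}) ` X \<Gamma>)" for \<Gamma>
    by (simp add: almost_prof_rigid_def X_def R_def quotient_def UNION_singleton_eq_range)
  have class_eq: "R `` {\<Delta>} = R `` {\<Delta>'} \<longleftrightarrow> cox_group \<Delta> \<cong> cox_group \<Delta>'" for \<Delta> \<Delta>'
  proof -
    \<comment> \<open>\<open>cox_group\<close> yields a group for every triple, so isomorphism is an
      equivalence on the whole type.\<close>
    have "equiv UNIV R" unfolding R_def
      by (auto intro!: equivI refl_onI symI transI intro: iso_refl group.iso_sym[OF group_cox_group] iso_trans)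
    then show ?thesis using eq_equiv_class_iff[of UNIV R \<Delta> \<Delta>'] by (simp add: R_def)
  qed
  have "finite ((\<lambda>\<Delta>. R `` {add_dihedral \<Delta>}) ` X \<Gamma>)"
  proof (rule finite_subset)
    show "(\<lambda>\<Delta>. R `` {add_dihedral \<Delta>}) ` X \<Gamma> \<subseteq> (\<lambda>\<Delta>. R `` {\<Delta>}) ` X (add_dihedral \<Gamma>)"
      using coxeter_graph_add_dihedral prof_iso_add_dihedral[OF \<Gamma>] by (auto simp: X_def)
    show "finite ((\<lambda>\<Delta>. R `` {\<Delta>}) ` X (add_dihedral \<Gamma>))" using rigid by (simp add: rig)
  qed
  then have "finite ((\<lambda>\<Delta>. R `` {\<Delta>}) ` X \<Gamma>)"
  proof (rule finite_image_factor)
    fix \<Delta> \<Delta>' assume "\<Delta> \<in> X \<Gamma>" "\<Delta>' \<in> X \<Gamma>" "R `` {add_dihedral \<Delta>} = R `` {add_dihedral \<Delta>'}"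
    then show "R `` {\<Delta>} = R `` {\<Delta>'}"
      unfolding class_eq using iso_add_dihedral_cancel by (auto simp: X_def)
  qed
  then show ?thesis by (simp add: rig)
qed

theorem theoremD:
  shows "(\<forall>\<Gamma>. coxeter_graph \<Gamma> \<longrightarrow> almost_prof_rigid \<Gamma>) \<longleftrightarrow>
         (\<forall>\<Gamma>. coxeter_graph \<Gamma> \<and> one_ended (cox_group \<Gamma>) (cox_gens \<Gamma>) \<longrightarrow> almost_prof_rigid \<Gamma>)"
proof (intro iffI allI impI)
  fix \<Gamma>
  assume *: "\<forall>\<Gamma>. coxeter_graph \<Gamma> \<and> one_ended (cox_group \<Gamma>) (cox_gens \<Gamma>) \<longrightarrow> almost_prof_rigid \<Gamma>"
    and \<Gamma>: "coxeter_graph \<Gamma>"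
  note \<Gamma>' = coxeter_graph_add_dihedral[OF \<Gamma>]
  have "almost_prof_rigid (add_dihedral (add_dihedral \<Gamma>))"
    using * coxeter_graph_add_dihedral[OF \<Gamma>']
      one_ended_add_dihedral[OF \<Gamma>' infinite_cox_group_add_dihedral[OF \<Gamma>]] by blast
  then show "almost_prof_rigid \<Gamma>"
    using almost_prof_rigid_add_dihedralD \<Gamma> \<Gamma>' by blast
qed blast

end
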